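(* Let $d\ge 1$ and let $X:=\{X(t)\}_{t\ge 0}$ be a Lévy process in $\mathbf{R}^d$, and let $\kappa=\{\kappa_\epsilon\}_{\epsilon\ge 0}$ be the family of functions $\kappa_\epsilon(t):=\mathrm{P}\{X(t)\in B(0,\epsilon)\}$, $\epsilon,t\ge 0$. Then for all nonrandom bounded Borel sets $F\subseteq\mathbf{R}_+=[0,\infty)$: $$\overline{\dim}_{\mathrm M}\, X(F)=\overline{\mathrm{Dim}}_\kappa F\quad\text{almost surely},$$ and $$\dim_{\mathrm P} X(F)=\mathrm{Dim}_\kappa F\quad\text{almost surely}.$$
   Context: A Lévy process in $\mathbf{R}^d$ is a process with $X(0)=0$, stationary and independent increments, and almost surely right-continuous paths with left limits. $X(F):=\{X(t):t\in F\}$. $|y|:=\max_{1\le j\le d}|y_j|$ is the $\ell^\infty$ norm on $\mathbf{R}^d$ and $B(x,r):=\{z\in\mathbf{R}^d:|z-x|<r\}$. For a Borel set $F\subseteq\mathbf{R}$, $\mathcal{P}(F)$ is the set of Borel probability measures $\nu$ on $\mathbf{R}$ with $\nu(F)=1$. The box-dimension profile of a Borel set $F\subseteq\mathbf{R}$ with respect to $\kappa$ is $$\overline{\mathrm{Dim}}_\kappa F:=\sup\left\{\eta>0:\ \liminf_{\epsilon\downarrow 0}\ \inf_{\nu\in\mathcal{P}(F)}\int\int\frac{\kappa_\epsilon(|t-s|)}{\epsilon^\eta}\,\nu(\mathrm{d}s)\,\nu(\mathrm{d}t)=0\right\}.$$ The packing dimension profile of a set $F\subseteq\mathbf{R}$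 with respect to $\kappa$ is $$\mathrm{Dim}_\kappa F:=\inf\ \sup_{n\ge 1}\overline{\mathrm{Dim}}_\kappa F_n,$$ where the infimum is over all countable coverings of $F$ by bounded Borel sets $F_1,F_2,\ldots\subseteq\mathbf{R}$. For a bounded set $G\subseteq\mathbf{R}^d$, $K_G(r)$ is the maximal number $m$ of points $x_1,\ldots,x_m\in G$ with $\min_{j\ne k}|x_j-x_k|\ge r$, and the upper Minkowski dimension is $\overline{\dim}_{\mathrm M}G:=\limsup_{r\downarrow 0}\log K_G(r)/\log(1/r)$. The packing dimension of $G\subseteq\mathbf{R}^d$ is $\dim_{\mathrm P}G:=\inf\sup_{n\ge1}\overline{\dim}_{\mathrm M}G_n$, the infimum being over all sequences of bounded Borel sets $G_1,G_2,\ldots$ with $G\subseteq\bigcup_n G_n$. Conventions: $\sup\varnothing:=0$, $\inf\varnothing:=+\infty$ (for the infimum over an empty set of measures), and all dimensions of the empty set are $0$. *)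

theory Defs
  imports "HOL-Probability.Probability"
begin

(* Time is real, but X t is constrained only for t >= 0. *)
locale levy_process = prob_space M
  for M :: "'w measure" +
  fixes X :: "real \<Rightarrow> 'w \<Rightarrow> real ^ 'd"
  assumes random_variable_X: "\<And>t. 0 \<le> t \<Longrightarrow> random_variable borel (X t)"
    and start_at_zero: "AE \<omega> in M. X 0 \<omega> = 0"
    and stationary_increments:
      "\<And>s t h. \<lbrakk>0 \<le> s; 0 \<le> t; 0 \<le> h\<rbrakk> \<Longrightarrow>
        distr M borel (\<lambda>\<omega>. X (s + h) \<omega> - X s \<omega>) = distr M borel (\<lambda>\<omega>. X (t + h) \<omega> - X t \<omega>)"
    and independent_increments:
      "\<And>(t :: nat \<Rightarrow> real) n. \<lbrakk>0 \<le> t 0; \<forall>i<n. t i \<le> t (Suc i)\<rbrakk> \<Longrightarrow>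
        indep_vars (\<lambda>_. borel) (\<lambda>i \<omega>. X (t (Suc i)) \<omega> - X (t i) \<omega>) {..<n}"
    and cadlag_paths:
      "AE \<omega> in M.
        (\<forall>t\<ge>0. continuous (at_right t) (\<lambda>s. X s \<omega>)) \<and>
        (\<forall>t>0. \<exists>l. ((\<lambda>s. X s \<omega>) \<longlongrightarrow> l) (at_left t))"

(* On real ^ 'd the library's infnorm is the maximum norm (infnorm_cart). *)
definition sup_ball :: "real ^ 'd \<Rightarrow> real \<Rightarrow> (real ^ 'd) set" where
  "sup_ball x r = {z. infnorm (z - x) < r}"

definition small_ball_family ::
  "'w measure \<Rightarrow> (real \<Rightarrow> 'w \<Rightarrow> real ^ 'd) \<Rightarrow> real \<Rightarrow> real \<Rightarrow> real" where
  "small_ball_family M X \<epsilon> t = measure M {\<omega> \<in> space M. X t \<omega> \<in> sup_ball 0 \<epsilon>}"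

definition borel_probs_on :: "real set \<Rightarrow> real measure set" where
  "borel_probs_on F = {\<nu>. prob_space \<nu> \<and> sets \<nu> = sets borel \<and> emeasure \<nu> F = 1}"

(* Inserting 0 only implements the convention that the supremum of the empty set is 0
   (in ereal it would be -\<infinity>).  The infimum over an empty set of measures is \<infinity> in ennreal. *)
definition box_dim_profile :: "(real \<Rightarrow> real \<Rightarrow> real) \<Rightarrow> real set \<Rightarrow> ereal" where
  "box_dim_profile \<kappa> F =
    Sup (insert 0 (ereal ` {\<eta>. \<eta> > 0 \<and>
      Liminf (at_right 0)
        (\<lambda>\<epsilon>. INF \<nu>\<in>borel_probs_on F.
          \<integral>\<^sup>+ t. (\<integral>\<^sup>+ s. ennreal (\<kappa> \<epsilon> \<bar>t - s\<bar> / \<epsilon> powr \<eta>) \<partial>\<nu>) \<partial>\<nu>) = 0}))"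

definition bounded_borel_covers :: "'a::metric_space set \<Rightarrow> (nat \<Rightarrow> 'a set) set" where
  "bounded_borel_covers A =
    {C. (\<forall>n. bounded (C n) \<and> C n \<in> sets borel) \<and> A \<subseteq> (\<Union>n. C n)}"

definition packing_dim_profile :: "(real \<Rightarrow> real \<Rightarrow> real) \<Rightarrow> real set \<Rightarrow> ereal" where
  "packing_dim_profile \<kappa> F = (INF C\<in>bounded_borel_covers F. SUP n. box_dim_profile \<kappa> (C n))"

(* Meaningful for bounded G and r > 0, when the set of cardinalities is finite.
   For r > 0 points at mutual distance at least r are distinct, so a set of points
   is the same as a list of points. *)
definition separation_number :: "(real ^ 'd) set \<Rightarrow> real \<Rightarrow> nat" where
  "separation_number G r =
    Max {card S |S. finite S \<and> S \<subseteq> G \<and> pairwise (\<lambda>x y. infnorm (x - y) \<ge> r) S}"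

definition upper_minkowski_dim :: "(real ^ 'd) set \<Rightarrow> ereal" where
  "upper_minkowski_dim G =
    (if G = {} then 0
     else Limsup (at_right 0) (\<lambda>r. ereal (ln (real (separation_number G r)) / ln (1 / r))))"

definition packing_dim :: "(real ^ 'd) set \<Rightarrow> ereal" where
  "packing_dim G = (INF C\<in>bounded_borel_covers G. SUP n. upper_minkowski_dim (C n))"

end

theory Submission
  imports Defs
begin

text \<open>
  Write \<open>\<kappa> \<epsilon> t\<close> for the probability that \<open>X t\<close> lies in the cube of radius \<open>\<epsilon>\<close> around \<open>0\<close>, and
  call the double integral of \<open>\<kappa> \<epsilon> \<bar>t - s\<bar>\<close> against a probability measure on times the
  \<open>\<epsilon>\<close>-energy of the measure.  The first half of the theorem says that the separation numbers of
  \<open>X(F)\<close> and the reciprocals of the least \<open>\<epsilon>\<close>-energies over \<open>F\<close> have the same upper growth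
  exponent as \<open>\<epsilon>\<close> tends to \<open>0\<close>.  Both inequalities come from finitely supported measures.

  \<^item> Given such a measure on times \<open>t i\<close> with weights \<open>w i\<close>, cover \<open>X(F)\<close> by \<open>K\<close> cubes.  Pairs of times
    whose points share a cube have total mass at least \<open>1 / K\<close> by Cauchy--Schwarz
    (\<open>separation_number_energy_ge_1\<close>), while the expected mass of pairs whose points are close is
    the energy, because increments are stationary.  So small energy at arbitrarily small scales
    forces large separation numbers, by Borel--Cantelli.

  \<^item> Conversely, run through a finite set of times in increasing order and keep a time iff its point
    is far from all points kept before.  Whether \<open>t i\<close> is kept is independent of the later increments,
    and no point is close to two kept ones.  Hence the measure that weights \<open>t i\<close> by the
    probability of being kept has energy at most twice the reciprocal of the expected number of kept
    times (\<open>greedy_weights_energy\<close>).  So a lower bound on all energies bounds that expected number,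
    which dominates the separation number; Fatou's lemma passes to a countable set of times that is
    dense from the right, and right continuity passes to \<open>F\<close>.

  For the first estimate, stochastic continuity allows a measure on the closure of a set \<open>D\<close> of times to be
  replaced by a finitely supported one on \<open>D\<close> (\<open>discretise_measure\<close>), so \<open>X(D)\<close> is already as
  large as the profile of the closure predicts.  This matters for the packing dimension.

  For the packing dimension the upper bound follows by applying the first half to the members of a
  cover of \<open>F\<close>.  For the lower bound a random cover of \<open>X(F)\<close> has to be compared with deterministic
  covers of \<open>F\<close>.  If the profile of \<open>F\<close> exceeds \<open>q\<close>, then \<open>F\<close> does not belong to the ideal of sets
  covered by countably many bounded Borel sets of box profile at most \<open>q\<close>.  A Borel set is
  a projection of a closed subset of a Polish space, and Baire's theorem provides a fixed countable
  family of sets outside of the ideal such that every countable closed cover of \<open>F\<close> has a member that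
  contains one set of the family (\<open>souslin_category\<close>).  Choose countable dense subsets \<open>D\<close> of
  the sets of the family.  Almost surely every \<open>X(D)\<close> has Minkowski dimension at least \<open>q\<close>, and
  the path is continuous at every time of every \<open>D\<close>.  Applied to the closures of the preimages of
  the members of a cover of \<open>X(F)\<close>, the category statement puts some \<open>X(D)\<close> into the closure of
  one of these members, whose Minkowski dimension is therefore at least \<open>q\<close>.
\<close>

section \<open>Separation numbers and the upper Minkowski dimension\<close>

lemma infnorm_diff_triangle:
  fixes x y z :: "'a::euclidean_space"
  shows "infnorm (x - z) \<le> infnorm (x - y) + infnorm (y - z)"
  using infnorm_triangle[of "x - y" "y - z"] by simp

definition separated :: "real \<Rightarrow> 'a::euclidean_space set \<Rightarrow> bool" where
  "separated r S \<longleftrightarrow> pairwise (\<lambda>x y. infnorm (x - y) \<ge> r) S"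

text \<open>
  Two points near the same point of \<open>N\<close> would be at distance less than \<open>r\<close>, so choosing a near point
  is injective on \<open>S\<close>.
\<close>

lemma card_le_of_near_points:
  fixes S N :: "'a::euclidean_space set"
  assumes "finite N" and S: "separated r S"
    and near: "\<And>x. x \<in> S \<Longrightarrow> \<exists>y\<in>N. infnorm (x - y) < r / 2"
  shows "finite S" and "card S \<le> card N"
proof -
  obtain c where c: "c x \<in> N" "infnorm (x - c x) < r / 2" if "x \<in> S" for x
    using near by metis
  have inj: "inj_on c S"
  proof (rule inj_onI, rule ccontr)
    fix x y assume xy: "x \<in> S" "y \<in> S" "c x = c y" "x \<noteq> y"
    have "infnorm (x - y) \<le> infnorm (x - c x) + infnorm (c x - y)"
      by (rule infnorm_diff_triangle)
    also have "infnorm (c x - y) = infnorm (y - c y)"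
      using xy(3) by (simp add: infnorm_sub)
    finally have "infnorm (x - y) < r"
      using c(2)[OF xy(1)] c(2)[OF xy(2)] by simp
    moreover have "r \<le> infnorm (x - y)"
      using S xy by (auto simp: separated_def pairwise_def)
    ultimately show False by simp
  qed
  have sub: "c ` S \<subseteq> N" using c by auto
  show "finite S" using inj sub \<open>finite N\<close> by (meson finite_imageD finite_subset)
  show "card S \<le> card N" using card_inj_on_le[OF inj sub \<open>finite N\<close>] .
qed

lemma bounded_finite_net:
  fixes G :: "'a::euclidean_space set"
  assumes "bounded G" "e > 0"
  obtains N where "finite N" "\<And>x. x \<in> G \<Longrightarrow> \<exists>y\<in>N. infnorm (x - y) < e"
proof -
  have "compact (closure G)" using assms by simp
  then obtain N where N: "finite N" "closure G \<subseteq> (\<Union>x\<in>N. ball x e)"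
    using seq_compact_imp_totally_bounded[of "closure G"] assms(2)
    by (metis compact_imp_seq_compact)
  have "\<exists>y\<in>N. infnorm (x - y) < e" if "x \<in> G" for x
  proof -
    have "x \<in> (\<Union>x\<in>N. ball x e)" using N(2) that closure_subset[of G] by blast
    then obtain y where "y \<in> N" "dist y x < e" by auto
    then show ?thesis
      using infnorm_le_norm[of "x - y"] by (force simp: dist_norm norm_minus_commute)
  qed
  with N(1) show thesis using that by blast
qed

lemma separated_card_bounded:
  fixes G :: "'a::euclidean_space set"
  assumes "bounded G" "r > 0"
  obtains m where "\<And>S. S \<subseteq> G \<Longrightarrow> separated r S \<Longrightarrow> finite S \<and> card S \<le> m"
proof -
  obtain N where N: "finite N" "\<And>x. x \<in> G \<Longrightarrow> \<exists>y\<in>N. infnorm (x - y) < r / 2"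
    using bounded_finite_net[of G "r/2"] assms by auto
  show thesis
    by (rule that[of "card N"]) (use card_le_of_near_points[OF N(1)] N(2) in blast)
qed

lemma separation_number_Max:
  fixes G :: "(real^'d) set"
  assumes "bounded G" "r > 0"
  shows "finite {card S |S. finite S \<and> S \<subseteq> G \<and> separated r S}"
    and "separation_number G r = Max {card S |S. finite S \<and> S \<subseteq> G \<and> separated r S}"
proof -
  obtain m where m: "\<And>S. S \<subseteq> G \<Longrightarrow> separated r S \<Longrightarrow> finite S \<and> card S \<le> m"
    using separated_card_bounded[OF assms] by blast
  show "finite {card S |S. finite S \<and> S \<subseteq> G \<and> separated r S}"
    by (rule finite_subset[of _ "{..m}"]) (use m in auto)
  show "separation_number G r = Max {card S |S. finite S \<and> S \<subseteq> G \<and> separated r S}"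
    by (simp add: separation_number_def separated_def)
qed

lemma card_le_separation_number:
  fixes G :: "(real^'d) set"
  assumes "bounded G" "r > 0" "S \<subseteq> G" "separated r S"
  shows "finite S" "card S \<le> separation_number G r"
proof -
  show "finite S" using separated_card_bounded[OF assms(1,2)] assms(3,4) by metis
  then show "card S \<le> separation_number G r"
    unfolding separation_number_Max(2)[OF assms(1,2)]
    using assms(3,4) by (intro Max_ge separation_number_Max(1)[OF assms(1,2)]) auto
qed

lemma separation_number_attained:
  fixes G :: "(real^'d) set"
  assumes "bounded G" "r > 0"
  obtains S where "finite S" "S \<subseteq> G" "separated r S" "card S = separation_number G r"
proof -
  have "{card S |S. finite S \<and> S \<subseteq> G \<and> separated r S} \<noteq> {}"
    by (auto simp: separated_def intro!: exI[of _ "{}"])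
  then have "separation_number G r \<in> {card S |S. finite S \<and> S \<subseteq> G \<and> separated r S}"
    unfolding separation_number_Max(2)[OF assms]
    by (intro Max_in separation_number_Max(1)[OF assms])
  then show thesis using that by auto
qed

lemma separation_number_le:
  fixes G :: "(real^'d) set"
  assumes "bounded G" "r > 0"
    and "\<And>S. finite S \<Longrightarrow> S \<subseteq> G \<Longrightarrow> separated r S \<Longrightarrow> card S \<le> m"
  shows "separation_number G r \<le> m"
  by (metis separation_number_attained[OF assms(1,2)] assms(3))

lemma separation_number_ge_1:
  fixes G :: "(real^'d) set"
  assumes "bounded G" "r > 0" "G \<noteq> {}"
  shows "separation_number G r \<ge> 1"
proof -
  obtain x where "x \<in> G" using assms by auto
  then show ?thesis
    using card_le_separation_number(2)[OF assms(1,2), of "{x}"] by (simp add: separated_def)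
qed

lemma separation_number_antimono_radius:
  fixes G :: "(real^'d) set"
  assumes "bounded G" "0 < r" "r \<le> r'"
  shows "separation_number G r' \<le> separation_number G r"
proof (rule separation_number_le)
  fix S assume "S \<subseteq> G" "separated r' S"
  moreover from this have "separated r S"
    using assms(3) unfolding separated_def pairwise_def by fastforce
  ultimately show "card S \<le> separation_number G r"
    using card_le_separation_number(2)[OF assms(1,2)] by blast
qed (use assms in auto)

text \<open>
  Moving each point of a separated set by less than \<open>r / 4\<close> into \<open>B\<close> reduces distances by less than
  \<open>r / 2\<close>.
\<close>

lemma separation_number_subset_closure:
  fixes A B :: "(real^'d) set"
  assumes "bounded B" "A \<subseteq> closure B" "r > 0"
  shows "separation_number A r \<le> separation_number B (r / 2)"
proof (rule separation_number_le)
  show "bounded A" using assms(1,2) bounded_subset bounded_closure by blast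
  fix S assume S: "finite S" "S \<subseteq> A" "separated r S"
  have "\<exists>y\<in>B. infnorm (x - y) < r / 4" if "x \<in> S" for x
  proof -
    have "x \<in> closure B" using that S(2) assms(2) by auto
    then obtain y where "y \<in> B" "dist y x < r / 4"
      using assms(3) by (meson closure_approachable zero_less_divide_iff zero_less_numeral)
    then show ?thesis
      using infnorm_le_norm[of "x - y"] by (force simp: dist_norm norm_minus_commute)
  qed
  then obtain c where c: "c x \<in> B" "infnorm (x - c x) < r / 4" if "x \<in> S" for x by metis
  have far: "r / 2 \<le> infnorm (c x - c y)" if "x \<in> S" "y \<in> S" "x \<noteq> y" for x y
  proof -
    have "r \<le> infnorm (x - y)" using S(3) that by (auto simp: separated_def pairwise_def)
    also have "\<dots> \<le> infnorm (x - c x) + infnorm (c x - y)" by (rule infnorm_diff_triangle)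
    also have "infnorm (c x - y) \<le> infnorm (c x - c y) + infnorm (c y - y)"
      by (rule infnorm_diff_triangle)
    also have "infnorm (c y - y) = infnorm (y - c y)" by (rule infnorm_sub)
    finally show ?thesis using c(2)[OF that(1)] c(2)[OF that(2)] by linarith
  qed
  have "inj_on c S"
  proof (rule inj_onI, rule ccontr)
    fix x y assume "x \<in> S" "y \<in> S" "c x = c y" "x \<noteq> y"
    then show False using far[of x y] assms(3) by (simp add: infnorm_0)
  qed
  then have "card S = card (c ` S)" by (simp add: card_image)
  also have "\<dots> \<le> separation_number B (r / 2)"
  proof (rule card_le_separation_number(2)[OF assms(1)])
    show "separated (r / 2) (c ` S)" using far by (auto simp: separated_def pairwise_def)
  qed (use assms c in auto)
  finally show "card S \<le> separation_number B (r / 2)" .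
qed (use assms in auto)

lemma eventually_at_right_0_lt: "a > 0 \<Longrightarrow> eventually (\<lambda>r::real. 0 < r \<and> r < a) (at_right 0)"
  by (auto simp: eventually_at_right_field)

lemma upper_minkowski_dim_nonneg:
  fixes G :: "(real^'d) set"
  assumes "bounded G"
  shows "0 \<le> upper_minkowski_dim G"
proof (cases "G = {}")
  case False
  have "eventually (\<lambda>r. 0 \<le> ereal (ln (real (separation_number G r)) / ln (1 / r))) (at_right 0)"
    using eventually_at_right_0_lt[of 1, simplified]
  proof eventually_elim
    case (elim r)
    then have "1 \<le> real (separation_number G r)"
      using separation_number_ge_1[OF assms _ False, of r] by simp
    then show ?case using elim by simp
  qed
  then have "0 \<le> Liminf (at_right 0) (\<lambda>r. ereal (ln (real (separation_number G r)) / ln (1 / r)))"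
    by (rule Liminf_bounded)
  also have "\<dots> \<le> Limsup (at_right 0) (\<lambda>r. ereal (ln (real (separation_number G r)) / ln (1 / r)))"
    by (rule Liminf_le_Limsup) simp
  finally show ?thesis using False by (simp add: upper_minkowski_dim_def)
qed (simp add: upper_minkowski_dim_def)

text \<open>
  Together with the next lemma this expresses the dimension by power bounds on the separation number,
  which are stable under constant factors in the number and in the radius.
\<close>

lemma upper_minkowski_dim_leI:
  fixes G :: "(real^'d) set"
  assumes "bounded G" "C > 0" "b \<ge> 0"
    and ev: "eventually (\<lambda>r. real (separation_number G r) \<le> C * r powr (- b)) (at_right 0)"
  shows "upper_minkowski_dim G \<le> ereal b"
proof (cases "G = {}")
  case False
  let ?f = "\<lambda>r. ln (real (separation_number G r)) / ln (1 / r)"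
  let ?g = "\<lambda>r::real. ln C / ln (1 / r) + b"
  have inv: "filterlim (\<lambda>r::real. 1 / r) at_top (at_right 0)"
    using filterlim_inverse_at_top_right by (simp add: inverse_eq_divide)
  have lninv: "filterlim (\<lambda>r::real. ln (1 / r)) at_top (at_right 0)"
    by (rule filterlim_compose[OF ln_at_top inv])
  have "((\<lambda>r::real. ln C / ln (1 / r)) \<longlongrightarrow> 0) (at_right 0)"
    by (rule tendsto_divide_0[OF tendsto_const]) (use lninv in \<open>simp add: filterlim_at_top_imp_at_infinity\<close>)
  then have "(?g \<longlongrightarrow> 0 + b) (at_right 0)" by (intro tendsto_intros)
  then have lim: "((\<lambda>r. ereal (?g r)) \<longlongrightarrow> ereal b) (at_right 0)" by simp
  have "eventually (\<lambda>r. ereal (?f r) \<le> ereal (?g r)) (at_right 0)"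
    using ev eventually_at_right_0_lt[of 1, simplified]
  proof eventually_elim
    case (elim r)
    then have K: "1 \<le> real (separation_number G r)"
      using separation_number_ge_1[OF assms(1) _ False, of r] by simp
    have l: "ln (1 / r) > 0" using elim by simp
    have "ln (real (separation_number G r)) \<le> ln (C * r powr (- b))"
      using elim K by simp
    also have "\<dots> = ln C + b * ln (1 / r)"
      using elim assms(2) by (simp add: ln_mult ln_powr ln_div)
    finally have "?f r \<le> (ln C + b * ln (1 / r)) / ln (1 / r)"
      using l by (simp add: divide_right_mono)
    also have "\<dots> = ?g r" using l by (simp add: add_divide_distrib)
    finally show ?case by simp
  qed
  then have "Limsup (at_right 0) (\<lambda>r. ereal (?f r)) \<le> Limsup (at_right 0) (\<lambda>r. ereal (?g r))"
    by (rule Limsup_mono)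
  also have "\<dots> = ereal b" using lim by (intro lim_imp_Limsup) auto
  finally show ?thesis using False by (simp add: upper_minkowski_dim_def)
qed (use assms in \<open>simp add: upper_minkowski_dim_def\<close>)

lemma upper_minkowski_dim_lessD:
  fixes G :: "(real^'d) set"
  assumes "bounded G" "G \<noteq> {}" "upper_minkowski_dim G < ereal b"
  shows "eventually (\<lambda>r. real (separation_number G r) \<le> r powr (- b)) (at_right 0)"
proof -
  have "Limsup (at_right 0) (\<lambda>r. ereal (ln (real (separation_number G r)) / ln (1 / r))) < ereal b"
    using assms by (simp add: upper_minkowski_dim_def)
  then have "eventually (\<lambda>r. ereal (ln (real (separation_number G r)) / ln (1 / r)) < ereal b) (at_right 0)"
    by (rule Limsup_lessD)
  then show ?thesis
    using eventually_at_right_0_lt[of 1, simplified]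
  proof eventually_elim
    case (elim r)
    then have K: "1 \<le> real (separation_number G r)"
      using separation_number_ge_1[OF assms(1) _ assms(2), of r] by simp
    have l: "ln (1 / r) > 0" using elim by simp
    have "ln (real (separation_number G r)) < b * ln (1 / r)"
      using elim(1) l by (simp add: pos_divide_less_eq)
    also have "\<dots> = ln (r powr (- b))" using elim by (simp add: ln_powr ln_div)
    finally show ?case using K elim by (subst (asm) ln_less_cancel_iff) auto
  qed
qed

lemma upper_minkowski_dim_subset_closure:
  fixes A B :: "(real^'d) set"
  assumes "bounded B" "A \<subseteq> closure B"
  shows "upper_minkowski_dim A \<le> upper_minkowski_dim B"
proof (cases "A = {}")
  case True
  then show ?thesis using upper_minkowski_dim_nonneg[OF assms(1)]
    by (simp add: upper_minkowski_dim_def)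
next
  case False
  have A: "bounded A" using assms bounded_subset bounded_closure by blast
  have B: "B \<noteq> {}" using False assms by auto
  show ?thesis
  proof (rule ereal_le_real, rule ccontr)
    fix b assume b: "upper_minkowski_dim B \<le> ereal b"
      and nle: "\<not> upper_minkowski_dim A \<le> ereal b"
    then obtain c where c: "ereal b < ereal c" "ereal c < upper_minkowski_dim A"
      using ereal_dense2 by (metis not_le)
    have "upper_minkowski_dim B < ereal c" using b c(1) by (rule le_less_trans)
    from upper_minkowski_dim_lessD[OF assms(1) B this]
    obtain d where d: "d > 0"
      "\<And>r. 0 < r \<Longrightarrow> r < d \<Longrightarrow> real (separation_number B r) \<le> r powr (- c)"
      by (auto simp: eventually_at_right_field)
    have "c \<ge> 0"
      using upper_minkowski_dim_nonneg[OF assms(1)] \<open>upper_minkowski_dim B < ereal c\<close>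
      by (metis ereal_less_eq(5) less_imp_le order_trans)
    have "eventually (\<lambda>r. real (separation_number A r) \<le> 2 powr c * r powr (- c)) (at_right 0)"
      using eventually_at_right_0_lt[OF d(1)]
    proof eventually_elim
      case (elim r)
      have "real (separation_number A r) \<le> real (separation_number B (r / 2))"
        using separation_number_subset_closure[OF assms, of r] elim by simp
      also have "\<dots> \<le> (r / 2) powr (- c)" using d(2)[of "r/2"] elim by simp
      also have "\<dots> = 2 powr c * r powr (- c)"
        using elim by (simp add: powr_divide powr_minus field_simps)
      finally show ?case .
    qed
    then have "upper_minkowski_dim A \<le> ereal c"
      by (intro upper_minkowski_dim_leI[OF A _ \<open>c \<ge> 0\<close>]) auto
    then show False using c by simp
  qed
qed

lemma upper_minkowski_dim_geI:
  fixes G :: "(real^'d) set"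
  assumes "bounded G" "G \<noteq> {}" "C > 0"
    and r: "\<And>n. r n > 0" "r \<longlonglongrightarrow> 0"
    and ev: "eventually (\<lambda>n. C * r n powr (- b) \<le> real (separation_number G (r n))) sequentially"
  shows "ereal b \<le> upper_minkowski_dim G"
proof (rule ccontr)
  assume "\<not> ereal b \<le> upper_minkowski_dim G"
  then obtain c where c: "upper_minkowski_dim G < ereal c" "ereal c < ereal b"
    using ereal_dense2 by (metis not_le)
  have rf: "filterlim r (at_right 0) sequentially"
    using r by (auto simp: filterlim_at less_imp_neq[THEN not_sym] intro!: always_eventually)
  have "eventually (\<lambda>n. real (separation_number G (r n)) \<le> r n powr (- c)) sequentially"
    by (rule eventually_compose_filterlim[OF upper_minkowski_dim_lessD[OF assms(1,2) c(1)] rf])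
  moreover have "((\<lambda>n. r n powr (b - c)) \<longlongrightarrow> 0) sequentially"
    by (rule tendsto_zero_powrI[OF r(2) tendsto_const]) (use c in \<open>auto simp: less_imp_le r(1)\<close>)
  then have "eventually (\<lambda>n. r n powr (b - c) < C) sequentially"
    using assms(3) by (rule order_tendstoD)
  ultimately have "eventually (\<lambda>n. False) sequentially"
    using ev
  proof eventually_elim
    case (elim n)
    have "C * r n powr (- b) \<le> r n powr (- c)" using elim by simp
    also have "\<dots> = r n powr (b - c) * r n powr (- b)"
      by (simp flip: powr_add)
    finally have "C \<le> r n powr (b - c)" using r(1)[of n] by simp
    then show False using elim by simp
  qed
  then show False by simp
qed

section \<open>Discrete energies and greedy separated sets\<close>

text \<open>
  The balls around the points of a maximal \<open>r\<close>-separated set cover, and two points of one ball are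
  at distance less than \<open>2 * r\<close>; so the double sum is at least the sum of the squared masses of
  the cells of a partition into at most \<open>separation_number G r\<close> cells, and Cauchy--Schwarz
  applies.
\<close>

lemma separation_number_energy_ge_1:
  fixes x :: "nat \<Rightarrow> real^'d" and w :: "nat \<Rightarrow> real"
  assumes "bounded G" "r > 0" and xG: "\<And>i. i < n \<Longrightarrow> x i \<in> G"
    and w: "\<And>i. i < n \<Longrightarrow> w i \<ge> 0" "(\<Sum>i<n. w i) = 1"
  shows "1 \<le> real (separation_number G r) *
    (\<Sum>i<n. \<Sum>j<n. w i * w j * indicator {v. infnorm v < 2 * r} (x i - x j))"
proof -
  obtain N where N: "finite N" "N \<subseteq> G" "separated r N" "card N = separation_number G r"
    using separation_number_attained[OF assms(1,2)] by blast
  have "\<exists>y\<in>N. infnorm (z - y) < r" if "z \<in> G" for z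
  proof (rule ccontr)
    assume *: "\<not> (\<exists>y\<in>N. infnorm (z - y) < r)"
    then have "z \<notin> N" using assms(2) by (force simp: infnorm_0)
    have "separated r (insert z N)"
      using * N(3) by (fastforce simp: separated_def pairwise_insert infnorm_sub not_less)
    then have "card (insert z N) \<le> separation_number G r"
      using N(2) that by (intro card_le_separation_number(2)[OF assms(1,2)]) auto
    then show False using N(1,4) \<open>z \<notin> N\<close> by simp
  qed
  then have "\<forall>i. \<exists>y. i < n \<longrightarrow> y \<in> N \<and> infnorm (x i - y) < r"
    using xG by blast
  then obtain c where "\<forall>i. i < n \<longrightarrow> c i \<in> N \<and> infnorm (x i - c i) < r" by metis
  then have c: "c i \<in> N" "infnorm (x i - c i) < r" if "i < n" for i
    using that by blast+
  have cell: "indicator {v. infnorm v < 2 * r} (x i - x j) = (1::real)"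
    if "i < n" "j < n" "c i = c j" for i j
  proof -
    have "infnorm (x i - x j) \<le> infnorm (x i - c i) + infnorm (c i - x j)"
      by (rule infnorm_diff_triangle)
    also have "infnorm (c i - x j) = infnorm (x j - c j)" using that by (simp add: infnorm_sub)
    finally show ?thesis using c(2)[OF that(1)] c(2)[OF that(2)] by simp
  qed
  let ?m = "\<lambda>y. \<Sum>i | i < n \<and> c i = y. w i"
  have mass: "(\<Sum>y\<in>N. ?m y)\<^sup>2 = 1"
  proof -
    have "(\<Sum>y\<in>N. ?m y) = (\<Sum>i<n. w i)"
      using sum.group[of "{..<n}" N c w] N(1) c(1) by (simp add: image_subset_iff)
    then show ?thesis using w(2) by simp
  qed
  have "(\<Sum>y\<in>N. (?m y)\<^sup>2) = (\<Sum>y\<in>N. \<Sum>i | i < n \<and> c i = y. \<Sum>j<n. w i * w j * of_bool (c i = c j))"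
  proof (rule sum.cong[OF refl])
    fix y
    have "(?m y)\<^sup>2 = (\<Sum>i | i < n \<and> c i = y. \<Sum>j | j < n \<and> c j = y. w i * w j)"
      by (simp add: power2_eq_square sum_product)
    also have "\<dots> = (\<Sum>i | i < n \<and> c i = y. \<Sum>j<n. w i * w j * of_bool (c i = c j))"
      by (intro sum.cong[OF refl] sum.mono_neutral_cong_left) auto
    finally show "(?m y)\<^sup>2 = \<dots>" .
  qed
  also have "\<dots> = (\<Sum>i<n. \<Sum>j<n. w i * w j * of_bool (c i = c j))"
    using sum.group[of "{..<n}" N c "\<lambda>i. \<Sum>j<n. w i * w j * of_bool (c i = c j)"] N(1) c(1)
    by (simp add: image_subset_iff)
  also have "\<dots> \<le> (\<Sum>i<n. \<Sum>j<n. w i * w j * indicator {v. infnorm v < 2 * r} (x i - x j))"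
  proof (intro sum_mono mult_left_mono)
    fix i j assume ij: "i \<in> {..<n}" "j \<in> {..<n}"
    show "of_bool (c i = c j) \<le> (indicator {v. infnorm v < 2 * r} (x i - x j) :: real)"
      using cell[of i j] ij by (cases "c i = c j") simp_all
    show "0 \<le> w i * w j" using w(1) ij by simp
  qed
  finally have le: "(\<Sum>y\<in>N. (?m y)\<^sup>2)
    \<le> (\<Sum>i<n. \<Sum>j<n. w i * w j * indicator {v. infnorm v < 2 * r} (x i - x j))" .
  have "1 \<le> (\<Sum>y\<in>N. (?m y)\<^sup>2) * card N"
    using sum_squared_le_sum_of_squares[of ?m N] unfolding mass .
  also have "\<dots> \<le> (\<Sum>i<n. \<Sum>j<n. w i * w j * indicator {v. infnorm v < 2 * r} (x i - x j)) * card N"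
    by (rule mult_right_mono[OF le]) simp
  finally show ?thesis unfolding N(4) by (subst mult.commute)
qed

text \<open>
  Going through the points in the order of their indices makes the choice of an index depend on the
  earlier points only, and on these only through differences; for the process this means dependence on
  past increments.
\<close>

primrec greedy :: "real \<Rightarrow> (nat \<Rightarrow> 'a::euclidean_space) \<Rightarrow> nat \<Rightarrow> nat set" where
  "greedy \<rho> x 0 = {}"
| "greedy \<rho> x (Suc n) =
    (if \<forall>j\<in>greedy \<rho> x n. \<rho> \<le> infnorm (x n - x j) then insert n (greedy \<rho> x n) else greedy \<rho> x n)"

lemma greedy_subset: "greedy \<rho> x n \<subseteq> {..<n}"
  by (induction n) auto

lemma finite_greedy [simp]: "finite (greedy \<rho> x n)"
  by (rule finite_subset[OF greedy_subset]) simp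

lemma greedy_stable: "i < n \<Longrightarrow> i \<in> greedy \<rho> x n \<longleftrightarrow> i \<in> greedy \<rho> x (Suc i)"
proof (induction n)
  case (Suc n)
  have "n \<notin> greedy \<rho> x n" using greedy_subset[of \<rho> x n] by auto
  show ?case
  proof (cases "i = n")
    case False
    then have "i \<in> greedy \<rho> x (Suc n) \<longleftrightarrow> i \<in> greedy \<rho> x n" by auto
    then show ?thesis using Suc False by simp
  qed simp
qed simp

lemma greedy_far:
  assumes "\<rho> > 0" "i \<in> greedy \<rho> x n" "j \<in> greedy \<rho> x n" "i \<noteq> j"
  shows "\<rho> \<le> infnorm (x i - x j)"
  using assms
proof (induction n)
  case (Suc n)
  show ?case
  proof (cases "i \<in> greedy \<rho> x n \<and> j \<in> greedy \<rho> x n")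
    case False
    then consider "i = n" "j \<in> greedy \<rho> x n" | "j = n" "i \<in> greedy \<rho> x n"
      using Suc.prems by (auto split: if_splits)
    then show ?thesis
    proof cases
      case 1
      then show ?thesis using Suc.prems greedy_subset[of \<rho> x n] by (auto split: if_splits)
    next
      case 2
      then have "\<rho> \<le> infnorm (x j - x i)"
        using Suc.prems greedy_subset[of \<rho> x n] by (auto split: if_splits)
      then show ?thesis by (simp only: infnorm_sub)
    qed
  qed (use Suc in auto)
qed simp

lemma greedy_near:
  assumes "\<rho> > 0" "i < n"
  shows "\<exists>j\<in>greedy \<rho> x n. infnorm (x i - x j) < \<rho>"
  using assms
proof (induction n)
  case (Suc n)
  then show ?case
    by (cases "i = n") (auto simp: infnorm_0 not_le intro: bexI[of _ n])
qed simp

lemma greedy_translate: "greedy \<rho> (\<lambda>i. x i - a) n = greedy \<rho> x n"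
  by (induction n) auto

lemma greedy_cong: "(\<And>i. i < n \<Longrightarrow> x i = y i) \<Longrightarrow> greedy \<rho> x n = greedy \<rho> y n"
proof (induction n)
  case (Suc n)
  then have "greedy \<rho> x n = greedy \<rho> y n" by simp
  moreover have "x n = y n" "\<And>j. j \<in> greedy \<rho> y n \<Longrightarrow> x j = y j"
    using Suc.prems greedy_subset[of \<rho> y n] by auto
  ultimately show ?case by simp
qed simp

lemma separated_card_le_greedy:
  assumes "\<rho> > 0" "separated (2 * \<rho>) S" "S \<subseteq> x ` {..<n}"
  shows "card S \<le> card (greedy \<rho> x n)"
proof -
  have "card S \<le> card (x ` greedy \<rho> x n)"
  proof (rule card_le_of_near_points(2)[OF _ assms(2)])
    fix z assume "z \<in> S"
    then obtain i where "i < n" "z = x i" using assms(3) by auto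
    then show "\<exists>y\<in>x ` greedy \<rho> x n. infnorm (z - y) < 2 * \<rho> / 2"
      using greedy_near[OF assms(1), of i n x] by auto
  qed simp
  also have "\<dots> \<le> card (greedy \<rho> x n)" by (rule card_image_le) simp
  finally show ?thesis .
qed

lemma card_greedy_near_le_1:
  assumes "\<rho> > 0"
  shows "card {i \<in> greedy \<rho> x n. infnorm (z - x i) < \<rho> / 2} \<le> 1"
proof -
  have "i = j" if "i \<in> greedy \<rho> x n" "infnorm (z - x i) < \<rho> / 2"
    "j \<in> greedy \<rho> x n" "infnorm (z - x j) < \<rho> / 2" for i j
  proof (rule ccontr)
    assume "i \<noteq> j"
    have "infnorm (x i - x j) \<le> infnorm (x i - z) + infnorm (z - x j)"
      by (rule infnorm_diff_triangle)
    also have "infnorm (x i - z) = infnorm (z - x i)" by (rule infnorm_sub)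
    finally show False using greedy_far[OF assms that(1,3) \<open>i \<noteq> j\<close>] that by simp
  qed
  then show ?thesis
    by (subst One_nat_def, subst card_le_Suc0_iff_eq) auto
qed

section \<open>Energies of finitely supported measures\<close>

definition energy ::
  "(real \<Rightarrow> real \<Rightarrow> real) \<Rightarrow> real \<Rightarrow> nat \<Rightarrow> (nat \<Rightarrow> real) \<Rightarrow> (nat \<Rightarrow> real) \<Rightarrow> real" where
  "energy \<kappa> \<epsilon> n w t = (\<Sum>i<n. \<Sum>j<n. w i * w j * \<kappa> \<epsilon> \<bar>t i - t j\<bar>)"

abbreviation profile_energy :: "(real \<Rightarrow> real \<Rightarrow> real) \<Rightarrow> real \<Rightarrow> real \<Rightarrow> real measure \<Rightarrow> ennreal" where
  "profile_energy \<kappa> \<eta> \<epsilon> \<nu> \<equiv> \<integral>\<^sup>+ t. (\<integral>\<^sup>+ s. ennreal (\<kappa> \<epsilon> \<bar>t - s\<bar> / \<epsilon> powr \<eta>) \<partial>\<nu>) \<partial>\<nu>"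

text \<open>
  The integral of a possibly nonmeasurable function is a lower integral, for which transport along
  \<open>t\<close> is an inequality.  This is the direction that bounds the infimum over all measures by the
  energy of a finitely supported one.
\<close>

lemma finitely_supported_probability:
  fixes t :: "nat \<Rightarrow> real"
  assumes F: "F \<in> sets borel" and t: "\<And>i. i < n \<Longrightarrow> t i \<in> F"
    and w: "\<And>i. i < n \<Longrightarrow> 0 \<le> w i" "(\<Sum>i<n. w i) = 1"
    and f: "\<And>x y. 0 \<le> f x y"
  obtains \<nu> where "\<nu> \<in> borel_probs_on F"
    "(\<integral>\<^sup>+x. (\<integral>\<^sup>+y. ennreal (f x y) \<partial>\<nu>) \<partial>\<nu>) \<le> ennreal (\<Sum>i<n. \<Sum>j<n. w i * w j * f (t i) (t j))"
proof -
  let ?P = "point_measure {..<n} (\<lambda>i. ennreal (w i))"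
  let ?N = "distr ?P borel t"
  have tm: "t \<in> ?P \<rightarrow>\<^sub>M borel" by (simp add: point_measure_def)
  have int: "(\<integral>\<^sup>+y. g y \<partial>?N) \<le> (\<Sum>i<n. ennreal (w i) * g (t i))" for g :: "real \<Rightarrow> ennreal"
  proof -
    have "(\<integral>\<^sup>+y. g y \<partial>?N) \<le> (\<integral>\<^sup>+i. g (t i) \<partial>?P)"
      unfolding nn_integral_def[of ?N]
    proof (rule SUP_least)
      fix h assume h: "h \<in> {h. simple_function ?N h \<and> h \<le> g}"
      have "integral\<^sup>S ?N h = integral\<^sup>N ?N h"
        using h by (simp add: nn_integral_eq_simple_integral)
      also have "\<dots> = (\<integral>\<^sup>+i. h (t i) \<partial>?P)"
        using h by (intro nn_integral_distr[OF tm]) (auto dest: borel_measurable_simple_function)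
      also have "\<dots> \<le> (\<integral>\<^sup>+i. g (t i) \<partial>?P)"
        using h by (intro nn_integral_mono) (auto simp: le_fun_def)
      finally show "integral\<^sup>S ?N h \<le> (\<integral>\<^sup>+i. g (t i) \<partial>?P)" .
    qed
    then show ?thesis by (simp add: nn_integral_point_measure_finite)
  qed
  have "emeasure ?N A = (\<Sum>i<n. ennreal (w i))" if "A \<in> sets borel" "\<And>i. i < n \<Longrightarrow> t i \<in> A" for A
  proof -
    have "emeasure ?N A = emeasure ?P {..<n}"
      using that by (subst emeasure_distr[OF tm])
        (auto intro!: arg_cong[where f="emeasure ?P"] simp: space_point_measure)
    then show ?thesis by (simp add: emeasure_point_measure_finite)
  qed
  moreover have "(\<Sum>i<n. ennreal (w i)) = 1"
    using w by (subst sum_ennreal) auto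
  ultimately have one: "emeasure ?N A = 1" if "A \<in> sets borel" "\<And>i. i < n \<Longrightarrow> t i \<in> A" for A
    using that by simp
  have N: "?N \<in> borel_probs_on F"
    using one[OF F t] one[of UNIV] by (auto simp: borel_probs_on_def intro!: prob_spaceI)
  have "(\<integral>\<^sup>+x. (\<integral>\<^sup>+y. ennreal (f x y) \<partial>?N) \<partial>?N)
      \<le> (\<Sum>i<n. ennreal (w i) * (\<integral>\<^sup>+y. ennreal (f (t i) y) \<partial>?N))"
    by (rule int)
  also have "\<dots> \<le> (\<Sum>i<n. ennreal (w i) * (\<Sum>j<n. ennreal (w j) * ennreal (f (t i) (t j))))"
    by (intro sum_mono mult_left_mono int) auto
  also have "\<dots> = ennreal (\<Sum>i<n. \<Sum>j<n. w i * w j * f (t i) (t j))"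
  proof -
    have "ennreal (\<Sum>i<n. \<Sum>j<n. w i * w j * f (t i) (t j)) = (\<Sum>i<n. \<Sum>j<n. ennreal (w i * w j * f (t i) (t j)))"
    proof -
      have nn: "0 \<le> w i * w j * f (t i) (t j)" if "i \<in> {..<n}" "j \<in> {..<n}" for i j
        using w(1) f that by simp
      have "ennreal (\<Sum>i<n. \<Sum>j<n. w i * w j * f (t i) (t j))
          = (\<Sum>i<n. ennreal (\<Sum>j<n. w i * w j * f (t i) (t j)))"
        by (rule sum_ennreal[symmetric]) (intro sum_nonneg nn)
      also have "\<dots> = (\<Sum>i<n. \<Sum>j<n. ennreal (w i * w j * f (t i) (t j)))"
        by (intro sum.cong[OF refl] sum_ennreal[symmetric] nn)
      finally show ?thesis .
    qed
    also have "\<dots> = (\<Sum>i<n. \<Sum>j<n. ennreal (w i) * (ennreal (w j) * ennreal (f (t i) (t j))))"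
      using w(1) f by (intro sum.cong) (auto simp: ennreal_mult mult.assoc)
    finally show ?thesis by (simp only: sum_distrib_left)
  qed
  finally show thesis by (rule that[OF N])
qed

section \<open>Independent increments and the greedy choice\<close>

lemma sets_infnorm_less [measurable]: "{v::real^'d. infnorm v < r} \<in> sets borel"
proof -
  have "{v::real^'d. infnorm v < r} = infnorm -` {..<r}" by auto
  also have "open \<dots>" by (intro open_vimage open_lessThan continuous_intros)
  finally show ?thesis by simp
qed

lemma borel_measurable_infnorm [measurable]: "(infnorm :: real^'d \<Rightarrow> real) \<in> borel_measurable borel"
  by (intro borel_measurable_continuous_onI continuous_intros)

lemma pred_greedy:
  fixes x :: "nat \<Rightarrow> 'a \<Rightarrow> real^'d"
  assumes [measurable]: "\<And>k. k < n \<Longrightarrow> x k \<in> borel_measurable M"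
  shows "Measurable.pred M (\<lambda>\<omega>. i \<in> greedy \<rho> (\<lambda>k. x k \<omega>) n)"
  using assms
proof (induction n arbitrary: i)
  case (Suc n)
  have [measurable]: "x k \<in> borel_measurable M" if "k \<le> n" for k
    using Suc.prems that by simp
  have IH [measurable]: "Measurable.pred M (\<lambda>\<omega>. j \<in> greedy \<rho> (\<lambda>k. x k \<omega>) n)" for j
    using Suc by simp
  have "(\<lambda>\<omega>. i \<in> greedy \<rho> (\<lambda>k. x k \<omega>) (Suc n)) = (\<lambda>\<omega>. i \<in> greedy \<rho> (\<lambda>k. x k \<omega>) n \<or>
     (i = n \<and> (\<forall>j\<in>{..<n}. j \<in> greedy \<rho> (\<lambda>k. x k \<omega>) n \<longrightarrow> \<rho> \<le> infnorm (x n \<omega> - x j \<omega>))))"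
    using greedy_subset[of \<rho> _ n] by (auto simp: fun_eq_iff)
  moreover have "Measurable.pred M \<dots>"
    by (intro pred_intros_logic pred_intros_finite IH) (auto intro!: pred_intros_logic)
  ultimately show ?case by simp
qed simp

context levy_process
begin

abbreviation "\<kappa> \<equiv> small_ball_family M X"

lemma kappa_nonneg: "0 \<le> \<kappa> \<epsilon> t"
  by (simp add: small_ball_family_def)

lemma measurable_X [measurable]: "0 \<le> t \<Longrightarrow> X t \<in> borel_measurable M"
  by (rule random_variable_X)

lemma prob_increment:
  assumes "0 \<le> s" "0 \<le> t"
  shows "prob {\<omega>\<in>space M. infnorm (X t \<omega> - X s \<omega>) < \<epsilon>} = \<kappa> \<epsilon> \<bar>t - s\<bar>"
proof -
  have *: "prob {\<omega>\<in>space M. infnorm (X t \<omega> - X s \<omega>) < \<epsilon>} = \<kappa> \<epsilon> (t - s)" if "0 \<le> s" "s \<le> t" for s t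
  proof -
    note [measurable] = measurable_X[of s] measurable_X[of t] measurable_X[of 0] measurable_X[of "t - s"]
    have "distr M borel (\<lambda>\<omega>. X (s + (t - s)) \<omega> - X s \<omega>)
        = distr M borel (\<lambda>\<omega>. X (0 + (t - s)) \<omega> - X 0 \<omega>)"
      using that by (intro stationary_increments) auto
    then have eq: "distr M borel (\<lambda>\<omega>. X t \<omega> - X s \<omega>) = distr M borel (\<lambda>\<omega>. X (t - s) \<omega> - X 0 \<omega>)"
      by simp
    have "prob {\<omega>\<in>space M. infnorm (X t \<omega> - X s \<omega>) < \<epsilon>}
      = measure (distr M borel (\<lambda>\<omega>. X t \<omega> - X s \<omega>)) {v. infnorm v < \<epsilon>}"
      using that by (subst measure_distr) (auto intro!: arg_cong[where f=prob])
    also have "\<dots> = prob {\<omega>\<in>space M. infnorm (X (t - s) \<omega> - X 0 \<omega>) < \<epsilon>}"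
      unfolding eq using that by (subst measure_distr) (auto intro!: arg_cong[where f=prob])
    also have "\<dots> = prob {\<omega>\<in>space M. infnorm (X (t - s) \<omega>) < \<epsilon>}"
      using start_at_zero that by (intro measure_eq_AE) auto
    finally show ?thesis by (simp add: small_ball_family_def sup_ball_def)
  qed
  show ?thesis
  proof (cases "s \<le> t")
    case False
    then show ?thesis using *[of t s] assms by (simp add: infnorm_sub[of "X t _"])
  qed (use * assms in simp)
qed

text \<open>
  Whether time \<open>t i\<close> is kept by the greedy choice is decided by the increments before
  \<open>t i\<close>, so it is independent of the increment from \<open>t i\<close> to \<open>t l\<close>.
\<close>

lemma prob_greedy_increment:
  fixes t :: "nat \<Rightarrow> real"
  assumes t: "mono t" "0 \<le> t 0" and il: "i \<le> l" "l < n"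
  shows "prob {\<omega>\<in>space M. i \<in> greedy \<rho> (\<lambda>k. X (t k) \<omega>) n \<and> infnorm (X (t l) \<omega> - X (t i) \<omega>) < \<epsilon>}
    = prob {\<omega>\<in>space M. i \<in> greedy \<rho> (\<lambda>k. X (t k) \<omega>) n} * \<kappa> \<epsilon> \<bar>t l - t i\<bar>"
proof -
  have t0: "0 \<le> t k" for k using t by (metis le0 monoD order_trans)
  define Y where "Y k \<omega> = X (t (Suc k)) \<omega> - X (t k) \<omega>" for k \<omega>
  have indep: "indep_vars (\<lambda>_. borel) Y {..<l}"
    unfolding Y_def using t by (intro independent_increments) (auto simp: mono_def)
  have tele: "X (t b) \<omega> - X (t a) \<omega> = (\<Sum>k\<in>{a..<b}. Y k \<omega>)" if "a \<le> b" for a b \<omega>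
    using sum_Suc_diff'[of a b "\<lambda>k. X (t k) \<omega>"] that by (simp add: Y_def)
  let ?A = "{..<i}" let ?B = "{i..<l}"
  have ind: "indep_var (PiM ?A (\<lambda>_. borel)) (\<lambda>\<omega>. \<lambda>k\<in>?A. Y k \<omega>) (PiM ?B (\<lambda>_. borel)) (\<lambda>\<omega>. \<lambda>k\<in>?B. Y k \<omega>)"
    using il by (intro indep_var_restrict[OF indep]) auto
  let ?U = "{y \<in> space (PiM ?A (\<lambda>_. borel::(real^'d) measure)). i \<in> greedy \<rho> (\<lambda>k. \<Sum>j<k. y j) (Suc i)}"
  let ?V = "{y \<in> space (PiM ?B (\<lambda>_. borel::(real^'d) measure)). infnorm (\<Sum>j\<in>?B. y j) < \<epsilon>}"
  have "(\<lambda>y. \<Sum>j<k. y j) \<in> borel_measurable (PiM ?A (\<lambda>_. borel::(real^'d) measure))" if "k \<le> i" for k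
    using that by (intro borel_measurable_sum measurable_component_singleton) auto
  then have "Measurable.pred (PiM ?A (\<lambda>_. borel::(real^'d) measure)) (\<lambda>y. i \<in> greedy \<rho> (\<lambda>k. \<Sum>j<k. y j) (Suc i))"
    by (intro pred_greedy) auto
  then have U: "?U \<in> sets (PiM ?A (\<lambda>_. borel))" by (simp only: pred_def)
  have [measurable]: "(\<lambda>y. \<Sum>j\<in>?B. y j) \<in> borel_measurable (PiM ?B (\<lambda>_. borel::(real^'d) measure))"
    by (intro borel_measurable_sum measurable_component_singleton) auto
  have V: "?V \<in> sets (PiM ?B (\<lambda>_. borel))" by measurable
  have gr: "i \<in> greedy \<rho> (\<lambda>k. X (t k) \<omega>) n \<longleftrightarrow> i \<in> greedy \<rho> (\<lambda>k. \<Sum>j<k. restrict (\<lambda>k. Y k \<omega>) ?A j) (Suc i)" for \<omega>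
  proof -
    have "i \<in> greedy \<rho> (\<lambda>k. X (t k) \<omega>) n \<longleftrightarrow> i \<in> greedy \<rho> (\<lambda>k. X (t k) \<omega>) (Suc i)"
      using greedy_stable il by (metis le_less_trans)
    also have "greedy \<rho> (\<lambda>k. X (t k) \<omega>) (Suc i) = greedy \<rho> (\<lambda>k. X (t k) \<omega> - X (t 0) \<omega>) (Suc i)"
      by (simp only: greedy_translate)
    also have "\<dots> = greedy \<rho> (\<lambda>k. \<Sum>j<k. restrict (\<lambda>k. Y k \<omega>) ?A j) (Suc i)"
    proof (rule greedy_cong)
      fix k assume "k < Suc i"
      then show "X (t k) \<omega> - X (t 0) \<omega> = (\<Sum>j<k. restrict (\<lambda>k. Y k \<omega>) ?A j)"
        using tele[of 0 k \<omega>] by (simp add: lessThan_atLeast0)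
    qed
    finally show ?thesis .
  qed
  have Ysp: "restrict (\<lambda>k. Y k \<omega>) I \<in> space (PiM I (\<lambda>_. borel))" for \<omega> I
    by (simp add: space_PiM)
  have inc: "X (t l) \<omega> - X (t i) \<omega> = (\<Sum>j\<in>?B. restrict (\<lambda>k. Y k \<omega>) ?B j)" for \<omega>
    using tele[OF il(1)] by simp
  have "prob {\<omega>\<in>space M. i \<in> greedy \<rho> (\<lambda>k. X (t k) \<omega>) n \<and> infnorm (X (t l) \<omega> - X (t i) \<omega>) < \<epsilon>}
    = prob ((\<lambda>\<omega>. (\<lambda>k\<in>?A. Y k \<omega>, \<lambda>k\<in>?B. Y k \<omega>)) -` (?U \<times> ?V) \<inter> space M)"
    unfolding gr inc using Ysp by (intro arg_cong[where f=prob]) auto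
  also have "\<dots> = prob ((\<lambda>\<omega>. \<lambda>k\<in>?A. Y k \<omega>) -` ?U \<inter> space M) * prob ((\<lambda>\<omega>. \<lambda>k\<in>?B. Y k \<omega>) -` ?V \<inter> space M)"
    by (rule indep_varD[OF ind U V])
  also have "(\<lambda>\<omega>. \<lambda>k\<in>?A. Y k \<omega>) -` ?U \<inter> space M = {\<omega>\<in>space M. i \<in> greedy \<rho> (\<lambda>k. X (t k) \<omega>) n}"
    unfolding gr using Ysp by auto
  also have "(\<lambda>\<omega>. \<lambda>k\<in>?B. Y k \<omega>) -` ?V \<inter> space M = {\<omega>\<in>space M. infnorm (X (t l) \<omega> - X (t i) \<omega>) < \<epsilon>}"
    unfolding inc using Ysp by auto
  also have "prob \<dots> = \<kappa> \<epsilon> \<bar>t l - t i\<bar>" by (rule prob_increment) (rule t0)+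
  finally show ?thesis .
qed

lemma sum_prob_le_card:
  assumes "finite I" "\<And>i. i \<in> I \<Longrightarrow> A i \<in> events"
    and "\<And>\<omega>. \<omega> \<in> space M \<Longrightarrow> card {i\<in>I. \<omega> \<in> A i} \<le> m"
  shows "(\<Sum>i\<in>I. prob (A i)) \<le> real m"
proof -
  have "(\<Sum>i\<in>I. prob (A i)) = expectation (\<lambda>\<omega>. \<Sum>i\<in>I. indicator (A i) \<omega>)"
    using assms by (subst Bochner_Integration.integral_sum) (auto simp: less_top[symmetric])
  also have "\<dots> \<le> expectation (\<lambda>\<omega>. real m)"
  proof (rule integral_mono)
    show "integrable M (\<lambda>\<omega>. \<Sum>i\<in>I. indicator (A i) \<omega> :: real)"
      using assms by (intro Bochner_Integration.integrable_sum) (auto simp: less_top[symmetric])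
    fix \<omega> assume "\<omega> \<in> space M"
    have "(\<Sum>i\<in>I. indicator (A i) \<omega> :: real) = card {i\<in>I. \<omega> \<in> A i}"
      using \<open>finite I\<close> by (simp add: indicator_def of_bool_def sum.If_cases Int_def)
    then show "(\<Sum>i\<in>I. indicator (A i) \<omega> :: real) \<le> real m"
      using assms(3)[OF \<open>\<omega> \<in> space M\<close>] by simp
  qed simp
  finally show ?thesis by (simp add: prob_space)
qed

text \<open>
  Weight each time by its probability of being kept by the greedy choice.  Whatever the position of
  the last point, at most one kept point is within \<open>\<rho> / 2\<close> of it; hence the energy of the
  normalised weights is small when the expected number of kept points is large.
\<close>

lemma greedy_weights_energy:
  fixes t :: "nat \<Rightarrow> real"
  assumes t: "mono t" "0 \<le> t 0" and "\<rho> > 0" "n > 0"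
  defines "q \<equiv> \<lambda>i. prob {\<omega>\<in>space M. i \<in> greedy \<rho> (\<lambda>k. X (t k) \<omega>) n}"
  defines "Z \<equiv> \<Sum>i<n. q i"
  shows "Z \<ge> 1" and "energy \<kappa> (\<rho> / 2) n (\<lambda>i. q i / Z) t \<le> 2 / Z"
    and "(\<integral>\<^sup>+\<omega>. ennreal (card (greedy \<rho> (\<lambda>k. X (t k) \<omega>) n)) \<partial>M) = ennreal Z"
proof -
  have t0: "0 \<le> t k" for k using t by (metis le0 monoD order_trans)
  have gm [measurable]: "Measurable.pred M (\<lambda>\<omega>. i \<in> greedy \<rho> (\<lambda>k. X (t k) \<omega>) n)" for i
    by (intro pred_greedy random_variable_X t0)
  have q0: "q i \<ge> 0" for i by (simp add: q_def)
  have "0 \<in> greedy \<rho> x n" for x :: "nat \<Rightarrow> real^'d"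
    using greedy_stable[of 0 n \<rho> x] \<open>n > 0\<close> by simp
  then have "q 0 = 1" by (simp add: q_def prob_space)
  moreover have "q 0 \<le> Z" unfolding Z_def using \<open>n > 0\<close> q0 by (intro member_le_sum) auto
  ultimately show Z: "Z \<ge> 1" by simp

  have one: "(\<Sum>i\<le>l. q i * \<kappa> (\<rho> / 2) \<bar>t l - t i\<bar>) \<le> 1" if l: "l < n" for l
  proof -
    let ?A = "\<lambda>i. {\<omega>\<in>space M. i \<in> greedy \<rho> (\<lambda>k. X (t k) \<omega>) n \<and> infnorm (X (t l) \<omega> - X (t i) \<omega>) < \<rho> / 2}"
    note [measurable] = measurable_X[OF t0[of l]] measurable_X[OF t0]
    have "(\<Sum>i\<le>l. q i * \<kappa> (\<rho> / 2) \<bar>t l - t i\<bar>) = (\<Sum>i\<le>l. prob (?A i))"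
      unfolding q_def by (intro sum.cong[OF refl] prob_greedy_increment[OF t _ l, symmetric]) simp
    also have "\<dots> \<le> real 1"
    proof (rule sum_prob_le_card)
      fix \<omega> assume "\<omega> \<in> space M"
      have "card {i\<in>{..l}. \<omega> \<in> ?A i}
        \<le> card {i \<in> greedy \<rho> (\<lambda>k. X (t k) \<omega>) n. infnorm (X (t l) \<omega> - X (t i) \<omega>) < \<rho> / 2}"
        by (intro card_mono) auto
      also have "\<dots> \<le> 1" by (rule card_greedy_near_le_1[OF \<open>\<rho> > 0\<close>])
      finally show "card {i\<in>{..l}. \<omega> \<in> ?A i} \<le> 1" .
    qed (simp, measurable)
    finally show ?thesis by simp
  qed

  \<comment> \<open>The preceding bound concerns pairs \<open>i \<le> l\<close>; symmetry accounts for the factor 2.\<close>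
  let ?f = "\<lambda>l i. q l * q i * \<kappa> (\<rho> / 2) \<bar>t l - t i\<bar>"
  have f: "?f l i \<ge> 0" "?f l i = ?f i l" for l i
    using q0 kappa_nonneg by (auto simp: abs_minus_commute)
  have "(\<Sum>l<n. \<Sum>i<n. ?f l i) \<le> (\<Sum>l<n. \<Sum>i<n. of_bool (i \<le> l) * ?f l i + of_bool (l \<le> i) * ?f l i)"
    using f(1) by (intro sum_mono) (auto simp: of_bool_def)
  also have "\<dots> = (\<Sum>l<n. \<Sum>i<n. of_bool (i \<le> l) * ?f l i) + (\<Sum>l<n. \<Sum>i<n. of_bool (l \<le> i) * ?f l i)"
    by (simp add: sum.distrib)
  also have "(\<Sum>l<n. \<Sum>i<n. of_bool (l \<le> i) * ?f l i) = (\<Sum>i<n. \<Sum>l<n. of_bool (l \<le> i) * ?f i l)"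
    by (subst sum.swap) (simp only: f(2))
  also have "(\<Sum>l<n. \<Sum>i<n. of_bool (i \<le> l) * ?f l i) = (\<Sum>l<n. q l * (\<Sum>i\<le>l. q i * \<kappa> (\<rho> / 2) \<bar>t l - t i\<bar>))"
    unfolding sum_distrib_left
    by (intro sum.cong[OF refl] sum.mono_neutral_cong_right) auto
  also have "(\<Sum>l<n. q l * (\<Sum>i\<le>l. q i * \<kappa> (\<rho> / 2) \<bar>t l - t i\<bar>)) \<le> (\<Sum>l<n. q l * 1)"
    using q0 one by (intro sum_mono mult_left_mono) auto
  finally have "(\<Sum>l<n. \<Sum>i<n. ?f l i) \<le> 2 * Z" unfolding Z_def by simp
  moreover have "energy \<kappa> (\<rho> / 2) n (\<lambda>i. q i / Z) t = (\<Sum>l<n. \<Sum>i<n. ?f l i) / Z\<^sup>2"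
    unfolding energy_def sum_divide_distrib by (simp add: power2_eq_square mult.assoc)
  ultimately have "energy \<kappa> (\<rho> / 2) n (\<lambda>i. q i / Z) t \<le> 2 * Z / Z\<^sup>2"
    by (simp add: divide_right_mono)
  then show "energy \<kappa> (\<rho> / 2) n (\<lambda>i. q i / Z) t \<le> 2 / Z"
    using Z by (simp add: power2_eq_square)

  have "ennreal (card (greedy \<rho> (\<lambda>k. X (t k) \<omega>) n))
      = (\<Sum>i<n. indicator {\<omega>\<in>space M. i \<in> greedy \<rho> (\<lambda>k. X (t k) \<omega>) n} \<omega>)"
    if "\<omega> \<in> space M" for \<omega>
  proof -
    have "{..<n} \<inter> greedy \<rho> (\<lambda>k. X (t k) \<omega>) n = greedy \<rho> (\<lambda>k. X (t k) \<omega>) n"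
      using greedy_subset by auto
    then show ?thesis
      using that by (simp add: indicator_def of_bool_def sum.If_cases ennreal_of_nat_eq_real_of_nat)
  qed
  then have "(\<integral>\<^sup>+\<omega>. ennreal (card (greedy \<rho> (\<lambda>k. X (t k) \<omega>) n)) \<partial>M)
    = (\<integral>\<^sup>+\<omega>. (\<Sum>i<n. indicator {\<omega>\<in>space M. i \<in> greedy \<rho> (\<lambda>k. X (t k) \<omega>) n} \<omega>) \<partial>M)"
    by (intro nn_integral_cong) simp
  also have "\<dots> = (\<Sum>i<n. emeasure M {\<omega>\<in>space M. i \<in> greedy \<rho> (\<lambda>k. X (t k) \<omega>) n})"
    by (subst nn_integral_sum) auto
  also have "\<dots> = ennreal Z"
    unfolding Z_def q_def by (simp add: emeasure_eq_measure sum_ennreal)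
  finally show "(\<integral>\<^sup>+\<omega>. ennreal (card (greedy \<rho> (\<lambda>k. X (t k) \<omega>) n)) \<partial>M) = ennreal Z" .
qed

text \<open>
  The greedy weights compete in the infimum, so a lower bound for the infimum bounds the expected
  number of kept points.
\<close>

lemma expected_greedy_le:
  fixes t :: "nat \<Rightarrow> real"
  assumes t: "mono t" "0 \<le> t 0" "\<And>i. t i \<in> F" and F: "F \<in> sets borel"
    and "\<epsilon> > 0" "c > 0"
    and c: "ennreal c \<le> (INF \<nu>\<in>borel_probs_on F. profile_energy \<kappa> \<eta> \<epsilon> \<nu>)"
  shows "(\<integral>\<^sup>+\<omega>. ennreal (card (greedy (2 * \<epsilon>) (\<lambda>k. X (t k) \<omega>) n)) \<partial>M) \<le> ennreal (2 / (c * \<epsilon> powr \<eta>))"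
proof (cases "n = 0")
  case False
  let ?q = "\<lambda>i. prob {\<omega>\<in>space M. i \<in> greedy (2 * \<epsilon>) (\<lambda>k. X (t k) \<omega>) n}"
  let ?Z = "\<Sum>i<n. ?q i"
  let ?w = "\<lambda>i. ?q i / ?Z"
  have n: "n > 0" using False by simp
  have eps: "2 * \<epsilon> > 0" using \<open>\<epsilon> > 0\<close> by simp
  note gw = greedy_weights_energy[OF t(1,2) eps n]
  have w1: "(\<Sum>i<n. ?w i) = 1" using gw(1) by (simp flip: sum_divide_distrib)
  obtain \<nu> where \<nu>: "\<nu> \<in> borel_probs_on F" "profile_energy \<kappa> \<eta> \<epsilon> \<nu>
      \<le> ennreal (\<Sum>i<n. \<Sum>j<n. ?w i * ?w j * (\<kappa> \<epsilon> \<bar>t i - t j\<bar> / \<epsilon> powr \<eta>))"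
    by (rule finitely_supported_probability[of F n t ?w "\<lambda>x y. \<kappa> \<epsilon> \<bar>x - y\<bar> / \<epsilon> powr \<eta>"])
      (use F t(3) w1 gw(1) in \<open>auto simp: kappa_nonneg\<close>)
  have "(\<Sum>i<n. \<Sum>j<n. ?w i * ?w j * (\<kappa> \<epsilon> \<bar>t i - t j\<bar> / \<epsilon> powr \<eta>)) = energy \<kappa> \<epsilon> n ?w t / \<epsilon> powr \<eta>"
    unfolding energy_def sum_divide_distrib by simp
  also have "\<dots> \<le> 2 / ?Z / \<epsilon> powr \<eta>"
    using gw(2) by (intro divide_right_mono) auto
  finally have "ennreal c \<le> ennreal (2 / ?Z / \<epsilon> powr \<eta>)"
    using c \<nu> by (meson INF_lower2 ennreal_leI order_trans)
  then have "c \<le> 2 / ?Z / \<epsilon> powr \<eta>"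
    using gw(1) by (subst (asm) ennreal_le_iff) auto
  then have "?Z \<le> 2 / (c * \<epsilon> powr \<eta>)"
    using gw(1) \<open>c > 0\<close> \<open>\<epsilon> > 0\<close> by (simp add: field_simps)
  then show ?thesis unfolding gw(3) by (rule ennreal_leI)
qed simp

end

section \<open>Stochastic continuity\<close>

definition regular_path :: "(real \<Rightarrow> 'a::real_normed_vector) \<Rightarrow> bool" where
  "regular_path f \<longleftrightarrow> (\<forall>t\<ge>0. continuous (at_right t) f) \<and> (\<forall>t>0. \<exists>l. (f \<longlongrightarrow> l) (at_left t))"

text \<open>
  Every time has a neighbourhood on which the path is bounded, by the one-sided limits; finitely many
  of these neighbourhoods cover a bounded set.
\<close>

lemma regular_path_bounded_image:
  assumes f: "regular_path f" and B: "bounded B" "B \<subseteq> {0..}"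
  shows "bounded (f ` B)"
proof -
  have "\<exists>U. open U \<and> t \<in> U \<and> bounded (f ` (U \<inter> {0..}))" if "0 \<le> t" for t
  proof -
    have "(f \<longlongrightarrow> f t) (at_right t)"
      using f that by (auto simp: regular_path_def continuous_within)
    then have "eventually (\<lambda>s. dist (f s) (f t) < 1) (at_right t)" by (rule tendstoD) simp
    then obtain b where b: "b > t" "\<And>s. t < s \<Longrightarrow> s < b \<Longrightarrow> dist (f s) (f t) < 1"
      by (auto simp: eventually_at_right_field)
    obtain a l where a: "a < t" "\<And>s. a < s \<Longrightarrow> s < t \<Longrightarrow> 0 \<le> s \<Longrightarrow> dist (f s) l < 1"
    proof (cases "t = 0")
      case False
      then have "t > 0" using \<open>0 \<le> t\<close> by simp
      then obtain l where "(f \<longlongrightarrow> l) (at_left t)" using f unfolding regular_path_def by blast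
      then have "eventually (\<lambda>s. dist (f s) l < 1) (at_left t)" by (rule tendstoD) simp
      then show ?thesis using that by (auto simp: eventually_at_left_field)
    qed (use that[of "-1"] in auto)
    have "f ` ({a<..<b} \<inter> {0..}) \<subseteq> insert (f t) (ball (f t) 1 \<union> ball l 1)"
    proof
      fix y assume "y \<in> f ` ({a<..<b} \<inter> {0..})"
      then obtain s where s: "a < s" "s < b" "0 \<le> s" "y = f s" by auto
      then show "y \<in> insert (f t) (ball (f t) 1 \<union> ball l 1)"
        using a(2)[of s] b(2)[of s] by (cases s t rule: linorder_cases) (auto simp: dist_commute)
    qed
    then have "bounded (f ` ({a<..<b} \<inter> {0..}))"
      by (rule bounded_subset[rotated]) auto
    then show ?thesis using a(1) b(1) by (intro exI[of _ "{a<..<b}"]) auto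
  qed
  then obtain U where U: "\<And>t. 0 \<le> t \<Longrightarrow> open (U t) \<and> t \<in> U t \<and> bounded (f ` (U t \<inter> {0..}))"
    by metis
  have cl: "closure B \<subseteq> {0..}" using B(2) by (simp add: closure_minimal)
  have "compact (closure B)" using B(1) by simp
  moreover have "\<And>t. t \<in> closure B \<Longrightarrow> open (U t)" using U cl by auto
  moreover have "closure B \<subseteq> (\<Union>t\<in>closure B. U t)" using U cl by blast
  ultimately obtain T where T: "T \<subseteq> closure B" "finite T" "closure B \<subseteq> (\<Union>t\<in>T. U t)"
    by (rule compactE_image)
  have "f ` B \<subseteq> (\<Union>t\<in>T. f ` (U t \<inter> {0..}))"
  proof
    fix y assume "y \<in> f ` B"
    then obtain s where s: "s \<in> B" "y = f s" by auto
    then have "s \<in> closure B" "s \<ge> 0" using closure_subset B(2) by auto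
    then show "y \<in> (\<Union>t\<in>T. f ` (U t \<inter> {0..}))" using T(3) s(2) by blast
  qed
  moreover have "bounded (\<Union>t\<in>T. f ` (U t \<inter> {0..}))"
    using T cl U by (intro bounded_UN) auto
  ultimately show ?thesis by (rule bounded_subset[rotated])
qed

context levy_process
begin

lemma AE_regular_path: "AE \<omega> in M. regular_path (\<lambda>t. X t \<omega>)"
  using cadlag_paths by (simp add: regular_path_def)

lemma kappa_0: "\<epsilon> > 0 \<Longrightarrow> \<kappa> \<epsilon> 0 = 1"
  using prob_increment[of 0 0 \<epsilon>] by (simp add: infnorm_0 prob_space)

lemma events_infnorm_X: "0 \<le> t \<Longrightarrow> {\<omega>\<in>space M. infnorm (X t \<omega>) < \<epsilon>} \<in> events"
  using measurable_X[of t] by measurable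

lemma events_infnorm_increment:
  assumes "0 \<le> s" "0 \<le> t" shows "{\<omega>\<in>space M. infnorm (X t \<omega> - X s \<omega>) < \<epsilon>} \<in> events"
proof -
  note [measurable] = measurable_X[OF assms(1)] measurable_X[OF assms(2)]
  show ?thesis by measurable
qed

lemma kappa_tendsto_1:
  assumes "\<epsilon> > 0"
  shows "(\<kappa> \<epsilon> \<longlongrightarrow> 1) (at_right 0)"
proof (rule tendsto_at_right_sequentially[of 0 1])
  fix S :: "nat \<Rightarrow> real"
  assume S: "\<And>n. 0 < S n" "S \<longlonglongrightarrow> 0"
  let ?A = "\<lambda>n. {\<omega>\<in>space M. infnorm (X (S n) \<omega>) < \<epsilon>}"
  have A: "?A n \<in> events" for n by (rule events_infnorm_X) (simp add: less_imp_le S)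
  have "(\<lambda>n. expectation (indicator (?A n))) \<longlonglongrightarrow> expectation (\<lambda>\<omega>. 1 :: real)"
  proof (rule integral_dominated_convergence[where w="\<lambda>_. 1"])
    show "AE \<omega> in M. (\<lambda>n. indicator (?A n) \<omega> :: real) \<longlonglongrightarrow> 1"
      using AE_regular_path start_at_zero AE_space
    proof eventually_elim
      case (elim \<omega>)
      then have "((\<lambda>t. X t \<omega>) \<longlongrightarrow> 0) (at_right 0)"
        by (auto simp: regular_path_def continuous_within)
      moreover have "filterlim S (at_right 0) sequentially"
        using S by (auto simp: filterlim_at less_imp_neq[THEN not_sym] intro!: always_eventually)
      ultimately have "(\<lambda>n. X (S n) \<omega>) \<longlonglongrightarrow> 0" by (rule filterlim_compose)
      then have "(\<lambda>n. infnorm (X (S n) \<omega>)) \<longlonglongrightarrow> infnorm (0 :: real^'d)" by (rule tendsto_infnorm)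
      then have "eventually (\<lambda>n. infnorm (X (S n) \<omega>) < \<epsilon>) sequentially"
        using \<open>\<epsilon> > 0\<close> by (intro order_tendstoD) (auto simp: infnorm_0)
      then have "eventually (\<lambda>n. indicator (?A n) \<omega> = (1 :: real)) sequentially"
        by eventually_elim (use elim in simp)
      then show ?case by (rule tendsto_eventually)
    qed
  qed (use A in \<open>auto simp: indicator_def\<close>)
  then show "(\<lambda>n. \<kappa> \<epsilon> (S n)) \<longlonglongrightarrow> 1"
    using A by (simp add: small_ball_family_def sup_ball_def prob_space)
qed simp

lemma kappa_near_1:
  assumes "\<epsilon> > 0" "\<delta> > 0"
  obtains h where "h > 0" "\<And>r. 0 \<le> r \<Longrightarrow> r < h \<Longrightarrow> 1 - \<delta> < \<kappa> \<epsilon> r"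
proof -
  have "eventually (\<lambda>r. 1 - \<delta> < \<kappa> \<epsilon> r) (at_right 0)"
    using kappa_tendsto_1[OF assms(1)] assms(2) by (intro order_tendstoD) auto
  then obtain h where h: "h > 0" "\<And>r. 0 < r \<Longrightarrow> r < h \<Longrightarrow> 1 - \<delta> < \<kappa> \<epsilon> r"
    by (auto simp: eventually_at_right_field)
  show thesis
  proof (rule that[OF h(1)])
    fix r :: real assume "0 \<le> r" "r < h"
    then show "1 - \<delta> < \<kappa> \<epsilon> r"
      using h(2)[of r] kappa_0[OF assms(1)] assms(2) by (cases "r = 0") auto
  qed
qed

text \<open>
  Triangle inequality and union bound: unless the increment between \<open>t\<close> and \<open>t'\<close> or the one between
  \<open>s\<close> and \<open>s'\<close> is at least \<open>b\<close>, replacing both times changes the increment by less than \<open>2 * b\<close>.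
\<close>

lemma kappa_perturb:
  assumes "0 \<le> s" "0 \<le> t" "0 \<le> s'" "0 \<le> t'" "a' + 2 * b \<le> a"
  shows "\<kappa> a' \<bar>t' - s'\<bar> \<le> \<kappa> a \<bar>t - s\<bar> + (1 - \<kappa> b \<bar>t - t'\<bar>) + (1 - \<kappa> b \<bar>s - s'\<bar>)"
proof -
  let ?A = "\<lambda>s t \<epsilon>. {\<omega>\<in>space M. infnorm (X t \<omega> - X s \<omega>) < \<epsilon>}"
  note ev = events_infnorm_increment
  have "?A s' t' a' \<subseteq> ?A s t a \<union> (space M - ?A t' t b) \<union> (space M - ?A s' s b)"
  proof (rule subsetI, rule ccontr)
    fix \<omega> assume 1: "\<omega> \<in> ?A s' t' a'"
      and 2: "\<omega> \<notin> ?A s t a \<union> (space M - ?A t' t b) \<union> (space M - ?A s' s b)"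
    have "infnorm (X t \<omega> - X s \<omega>) \<le> infnorm (X t \<omega> - X t' \<omega>) + infnorm (X t' \<omega> - X s \<omega>)"
      by (rule infnorm_diff_triangle)
    also have "infnorm (X t' \<omega> - X s \<omega>) \<le> infnorm (X t' \<omega> - X s' \<omega>) + infnorm (X s' \<omega> - X s \<omega>)"
      by (rule infnorm_diff_triangle)
    also have "infnorm (X s' \<omega> - X s \<omega>) = infnorm (X s \<omega> - X s' \<omega>)" by (rule infnorm_sub)
    finally show False using 1 2 assms(5) by auto
  qed
  then have "prob (?A s' t' a') \<le> prob (?A s t a \<union> (space M - ?A t' t b) \<union> (space M - ?A s' s b))"
    using assms by (intro finite_measure_mono) (auto intro!: sets.Un sets.compl_sets ev)
  also have "\<dots> \<le> prob (?A s t a \<union> (space M - ?A t' t b)) + prob (space M - ?A s' s b)"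
    using assms by (intro measure_Un_le) (auto intro!: sets.Un sets.compl_sets ev)
  also have "prob (?A s t a \<union> (space M - ?A t' t b)) \<le> prob (?A s t a) + prob (space M - ?A t' t b)"
    using assms by (intro measure_Un_le) (auto intro!: sets.Un sets.compl_sets ev)
  also have "prob (space M - ?A t' t b) = 1 - prob (?A t' t b)"
    using assms by (intro prob_compl ev)
  also have "prob (space M - ?A s' s b) = 1 - prob (?A s' s b)"
    using assms by (intro prob_compl ev)
  finally show ?thesis using assms by (simp add: prob_increment)
qed

text \<open>
  The balls are open, so the probability is the limit of the probabilities for smaller radii.
\<close>

lemma kappa_lower_radius:
  assumes "0 \<le> t" "a < \<kappa> \<epsilon> t"
  obtains r where "r < \<epsilon>" "a < \<kappa> r t"
proof -
  let ?A = "\<lambda>n. {\<omega>\<in>space M. infnorm (X t \<omega>) < \<epsilon> - 1 / real (Suc n)}"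
  have "(\<lambda>n. prob (?A n)) \<longlonglongrightarrow> prob (\<Union>n. ?A n)"
  proof (rule finite_Lim_measure_incseq)
    show "range ?A \<subseteq> events" using events_infnorm_X[OF assms(1)] by auto
    show "incseq ?A"
    proof (rule incseq_SucI, rule subsetI)
      fix n \<omega> assume "\<omega> \<in> ?A n"
      moreover have "1 / real (Suc (Suc n)) \<le> 1 / real (Suc n)" by (simp add: frac_le)
      ultimately show "\<omega> \<in> ?A (Suc n)" by auto
    qed
  qed
  moreover have "(\<Union>n. ?A n) = {\<omega>\<in>space M. infnorm (X t \<omega>) < \<epsilon>}"
  proof (intro equalityI subsetI)
    fix \<omega> assume \<omega>: "\<omega> \<in> {\<omega>\<in>space M. infnorm (X t \<omega>) < \<epsilon>}"
    then obtain n where "1 / real (Suc n) < \<epsilon> - infnorm (X t \<omega>)"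
      using nat_approx_posE[of "\<epsilon> - infnorm (X t \<omega>)"] by auto
    then show "\<omega> \<in> (\<Union>n. ?A n)" using \<omega> by (auto simp: algebra_simps intro!: exI[of _ n])
  next
    fix \<omega> assume "\<omega> \<in> (\<Union>n. ?A n)"
    then obtain n where "\<omega> \<in> space M" "infnorm (X t \<omega>) < \<epsilon> - 1 / real (Suc n)" by auto
    moreover from this have "infnorm (X t \<omega>) < \<epsilon>" by (rule_tac less_trans) auto
    ultimately show "\<omega> \<in> {\<omega>\<in>space M. infnorm (X t \<omega>) < \<epsilon>}" by simp
  qed
  ultimately have "(\<lambda>n. prob (?A n)) \<longlonglongrightarrow> \<kappa> \<epsilon> t"
    by (simp add: small_ball_family_def sup_ball_def)
  then have "eventually (\<lambda>n. a < prob (?A n)) sequentially"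
    using assms(2) by (rule order_tendstoD)
  then obtain n where "a < prob (?A n)" by (auto simp: eventually_sequentially)
  then show thesis
    by (intro that[of "\<epsilon> - 1 / real (Suc n)"]) (auto simp: small_ball_family_def sup_ball_def)
qed

text \<open>
  By stochastic continuity the function is lower semicontinuous: a slightly smaller radius leaves room
  for the increment between two nearby times.
\<close>

lemma borel_measurable_kappa [measurable]: "(\<lambda>t. \<kappa> \<epsilon> \<bar>t\<bar>) \<in> borel_measurable borel"
proof -
  have "open {t. a < \<kappa> \<epsilon> \<bar>t\<bar>}" for a
    unfolding open_dist
  proof (intro ballI)
    fix t assume "t \<in> {t. a < \<kappa> \<epsilon> \<bar>t\<bar>}"
    then obtain r where r: "r < \<epsilon>" "a < \<kappa> r \<bar>t\<bar>" using kappa_lower_radius[of "\<bar>t\<bar>"] by auto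
    obtain h where h: "h > 0" "\<And>u. 0 \<le> u \<Longrightarrow> u < h \<Longrightarrow> 1 - (\<kappa> r \<bar>t\<bar> - a) < \<kappa> ((\<epsilon> - r) / 2) u"
      using kappa_near_1[of "(\<epsilon> - r) / 2" "\<kappa> r \<bar>t\<bar> - a"] r by auto
    have "a < \<kappa> \<epsilon> \<bar>u\<bar>" if "dist u t < h" for u
    proof -
      have "\<kappa> r \<bar>\<bar>t\<bar> - 0\<bar> \<le> \<kappa> \<epsilon> \<bar>\<bar>u\<bar> - 0\<bar> + (1 - \<kappa> ((\<epsilon> - r) / 2) \<bar>\<bar>u\<bar> - \<bar>t\<bar>\<bar>) + (1 - \<kappa> ((\<epsilon> - r) / 2) \<bar>0 - 0\<bar>)"
        by (rule kappa_perturb) (auto simp: field_simps)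
      moreover have "\<kappa> ((\<epsilon> - r) / 2) 0 = 1" using r by (intro kappa_0) auto
      moreover have "1 - (\<kappa> r \<bar>t\<bar> - a) < \<kappa> ((\<epsilon> - r) / 2) \<bar>\<bar>u\<bar> - \<bar>t\<bar>\<bar>"
        using that by (intro h(2)) (auto simp: dist_real_def)
      ultimately show ?thesis by simp
    qed
    then show "\<exists>e>0. \<forall>y. dist y t < e \<longrightarrow> y \<in> {t. a < \<kappa> \<epsilon> \<bar>t\<bar>}" using h(1) by auto
  qed
  then show ?thesis by (subst borel_measurable_iff_greater) auto
qed

end

section \<open>The lower bound for the Minkowski dimension\<close>

text \<open>
  Markov's inequality and the first Borel--Cantelli lemma.
\<close>

lemma (in prob_space) AE_eventually_le_1_of_summable:
  fixes Y :: "nat \<Rightarrow> 'a \<Rightarrow> ennreal"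
  assumes [measurable]: "\<And>n. Y n \<in> borel_measurable M"
    and le: "\<And>n. (\<integral>\<^sup>+\<omega>. Y n \<omega> \<partial>M) \<le> ennreal (c n)" and c: "\<And>n. 0 \<le> c n" "summable c"
  shows "AE \<omega> in M. eventually (\<lambda>n. Y n \<omega> \<le> 1) sequentially"
proof -
  let ?A = "\<lambda>n. {\<omega>\<in>space M. 1 \<le> 1 * Y n \<omega>}"
  have A: "measure M (?A n) \<le> c n" for n
  proof -
    have "emeasure M (?A n) \<le> 1 * (\<integral>\<^sup>+\<omega>. Y n \<omega> * indicator (space M) \<omega> \<partial>M)"
      by (rule nn_integral_Markov_inequality) auto
    also have "\<dots> = (\<integral>\<^sup>+\<omega>. Y n \<omega> \<partial>M)" by (auto intro!: nn_integral_cong)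
    finally have "emeasure M (?A n) \<le> ennreal (c n)" using le[of n] by (rule order_trans)
    then show ?thesis using c(1)[of n] by (simp add: emeasure_eq_measure)
  qed
  have "AE \<omega> in M. eventually (\<lambda>n. \<omega> \<in> space M - ?A n) sequentially"
  proof (rule borel_cantelli_AE1)
    show "?A n \<in> sets M" for n by measurable
    show "emeasure M (?A n) < \<infinity>" for n by (simp add: less_top[symmetric])
    show "summable (\<lambda>n. measure M (?A n))"
      by (rule summable_comparison_test'[OF c(2), of 0]) (use A in simp)
  qed
  then show ?thesis
  proof eventually_elim
    case (elim \<omega>)
    then show ?case by (rule eventually_mono) (auto simp: not_le)
  qed
qed

context levy_process
begin

lemma borel_measurable_kappa_diff [measurable]:
  "(\<lambda>(x, y). \<kappa> \<epsilon> \<bar>x - y\<bar>) \<in> borel_measurable (borel \<Otimes>\<^sub>M borel)"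
proof -
  have "(\<lambda>p::real \<times> real. \<kappa> \<epsilon> \<bar>(\<lambda>p. fst p - snd p) p\<bar>) \<in> borel_measurable (borel \<Otimes>\<^sub>M borel)"
    by (rule measurable_compose[OF _ borel_measurable_kappa]) measurable
  then show ?thesis by (simp add: case_prod_beta')
qed

text \<open>
  A measure near \<open>D\<close> is discretised by moving the mass of small Borel cells into points of
  \<open>D\<close>.  By stochastic continuity this changes the energy little, at the price of half the radius.
\<close>

lemma discretise_measure:
  assumes \<nu>: "\<nu> \<in> borel_probs_on F" and F: "F \<in> sets borel" "F \<subseteq> closure D"
    and D: "bounded D" "D \<subseteq> {0..}" and "\<epsilon> > 0" "\<delta> > 0"
  obtains n w t where "\<And>i. i < n \<Longrightarrow> t i \<in> D" "\<And>i. i < n \<Longrightarrow> 0 \<le> w i" "(\<Sum>i<n. w i) = 1"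
    "ennreal (energy \<kappa> (\<epsilon> / 2) n w t) \<le> (\<integral>\<^sup>+x. \<integral>\<^sup>+y. ennreal (\<kappa> \<epsilon> \<bar>x - y\<bar>) \<partial>\<nu> \<partial>\<nu>) + ennreal \<delta>"
proof -
  interpret \<nu>: prob_space \<nu> using \<nu> by (simp add: borel_probs_on_def)
  have sets_nu [measurable_cong]: "sets \<nu> = sets borel" using \<nu> by (simp add: borel_probs_on_def)
  have space_nu: "space \<nu> = UNIV" using sets_eq_imp_space_eq[OF sets_nu] by simp
  have nuF: "emeasure \<nu> F = 1" using \<nu> by (simp add: borel_probs_on_def)
  have clD: "closure D \<subseteq> {0..}" using D(2) by (simp add: closure_minimal)
  have F0: "x \<ge> 0" if "x \<in> F" for x using that F(2) clD by auto
  obtain h where h: "h > 0" "\<And>r. 0 \<le> r \<Longrightarrow> r < h \<Longrightarrow> 1 - \<delta> / 2 < \<kappa> (\<epsilon> / 4) r"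
    using kappa_near_1[of "\<epsilon> / 4" "\<delta> / 2"] assms by auto
  have "compact (closure D)" using D(1) by simp
  moreover have "\<And>d. d \<in> D \<Longrightarrow> open (ball d h)" by simp
  moreover have "closure D \<subseteq> (\<Union>d\<in>D. ball d h)"
    using h(1) by (force simp: closure_approachable dist_commute)
  ultimately obtain N where N: "N \<subseteq> D" "finite N" "closure D \<subseteq> (\<Union>d\<in>N. ball d h)"
    by (rule compactE_image)
  obtain t where t: "bij_betw t {..<card N} N"
    using ex_bij_betw_nat_finite[OF N(2)] by (auto simp: lessThan_atLeast0)
  define n where "n = card N"
  have tN: "t i \<in> N" if "i < n" for i using t that by (auto simp: n_def bij_betw_def)
  have t0: "t i \<ge> 0" if "i < n" for i using tN[OF that] N(1) D(2) by auto
  have tcover: "\<exists>i<n. \<bar>x - t i\<bar> < h" if "x \<in> F" for x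
  proof -
    have "x \<in> (\<Union>d\<in>N. ball d h)" using that F(2) N(3) by blast
    then obtain d where "d \<in> N" "dist d x < h" by auto
    moreover have "d \<in> t ` {..<n}" using t calculation by (simp add: n_def bij_betw_def)
    ultimately show ?thesis by (auto simp: dist_real_def abs_minus_commute)
  qed
  \<comment> \<open>The cell of \<open>t i\<close>: the points of \<open>F\<close> for which \<open>i\<close> is the first index with \<open>t i\<close> near.\<close>
  define A where "A i = {x \<in> F. \<bar>x - t i\<bar> < h \<and> (\<forall>j<i. \<not> \<bar>x - t j\<bar> < h)}" for i
  have A_sets [measurable]: "A i \<in> sets borel" for i
  proof -
    have "A i = F \<inter> {x. \<bar>x - t i\<bar> < h \<and> (\<forall>j\<in>{..<i}. \<not> \<bar>x - t j\<bar> < h)}" by (auto simp: A_def)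
    moreover have "{x. \<bar>x - t i\<bar> < h \<and> (\<forall>j\<in>{..<i}. \<not> \<bar>x - t j\<bar> < h)} \<in> sets borel" by measurable
    ultimately show ?thesis using F(1) by simp
  qed
  have A_disj: "i = j" if "x \<in> A i" "x \<in> A j" for i j x
    using that by (cases i j rule: linorder_cases) (auto simp: A_def)
  have A_F: "A i \<subseteq> F" for i by (auto simp: A_def)
  have A_cover: "F \<subseteq> (\<Union>i<n. A i)"
  proof
    fix x assume x: "x \<in> F"
    define i where "i = (LEAST i. i < n \<and> \<bar>x - t i\<bar> < h)"
    have "i < n \<and> \<bar>x - t i\<bar> < h" unfolding i_def using tcover[OF x] by (rule LeastI_ex)
    moreover have "\<not> \<bar>x - t j\<bar> < h" if "j < i" for j
      using not_less_Least[of j "\<lambda>i. i < n \<and> \<bar>x - t i\<bar> < h"] that calculation by (auto simp: i_def)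
    ultimately show "x \<in> (\<Union>i<n. A i)" using x by (auto simp: A_def)
  qed
  define w where "w i = measure \<nu> (A i)" for i
  have w: "w i \<ge> 0" "emeasure \<nu> (A i) = ennreal (w i)" for i
    by (simp_all add: w_def \<nu>.emeasure_eq_measure)
  have "(\<Sum>i<n. w i) = measure \<nu> (\<Union>i<n. A i)"
    unfolding w_def using A_disj
    by (intro \<nu>.finite_measure_finite_Union[symmetric]) (auto simp: disjoint_family_on_def sets_nu)
  also have "(\<Union>i<n. A i) = F" using A_cover A_F by auto
  also have "measure \<nu> F = 1" using nuF by (simp add: measure_def)
  finally have w1: "(\<Sum>i<n. w i) = 1" .

  let ?k = "\<lambda>i j. \<kappa> (\<epsilon> / 2) \<bar>t i - t j\<bar>"
  have k: "?k i j \<ge> 0" for i j by (rule kappa_nonneg)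
  have cell: "ennreal (?k i j) * (indicator (A i) x * indicator (A j) y)
      \<le> (ennreal (\<kappa> \<epsilon> \<bar>x - y\<bar>) + ennreal \<delta>) * (indicator (A i) x * indicator (A j) y)"
    if ij: "i < n" "j < n" for i j x y
  proof (cases "x \<in> A i \<and> y \<in> A j")
    case True
    then have xy: "\<bar>x - t i\<bar> < h" "\<bar>y - t j\<bar> < h" "x \<ge> 0" "y \<ge> 0"
      using F0 by (auto simp: A_def)
    have "?k i j \<le> \<kappa> \<epsilon> \<bar>x - y\<bar> + (1 - \<kappa> (\<epsilon> / 4) \<bar>x - t i\<bar>) + (1 - \<kappa> (\<epsilon> / 4) \<bar>y - t j\<bar>)"
      using xy t0[OF ij(1)] t0[OF ij(2)] by (intro kappa_perturb) auto
    also have "\<dots> \<le> \<kappa> \<epsilon> \<bar>x - y\<bar> + \<delta>"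
      using h(2)[of "\<bar>x - t i\<bar>"] h(2)[of "\<bar>y - t j\<bar>"] xy by simp
    finally show ?thesis
      using True \<open>\<delta> > 0\<close> kappa_nonneg by (simp flip: ennreal_plus)
  qed auto
  have single: "(\<Sum>i<n. \<Sum>j<n. (indicator (A i) x * indicator (A j) y :: ennreal)) \<le> 1" for x y
  proof -
    have s: "(\<Sum>i<n. indicator (A i) x :: ennreal) \<le> 1" for x
    proof (cases "\<exists>i<n. x \<in> A i")
      case True
      then obtain i where i: "i < n" "x \<in> A i" by auto
      then have "(\<Sum>j<n. indicator (A j) x :: ennreal) = (\<Sum>j<n. if j = i then 1 else 0)"
        using A_disj by (intro sum.cong) (auto simp: indicator_def)
      then show ?thesis using i by simp
    qed auto
    have "(\<Sum>i<n. \<Sum>j<n. (indicator (A i) x * indicator (A j) y :: ennreal))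
      = (\<Sum>i<n. indicator (A i) x) * (\<Sum>j<n. indicator (A j) y)"
      by (simp add: sum_product)
    also have "\<dots> \<le> 1 * 1" by (intro mult_mono s) auto
    finally show ?thesis by simp
  qed
  have "ennreal (energy \<kappa> (\<epsilon> / 2) n w t) = (\<Sum>i<n. \<Sum>j<n. ennreal (w i * w j * ?k i j))"
    unfolding energy_def using w(1) k
    by (subst sum_ennreal[symmetric], force intro: sum_nonneg)
       (intro sum.cong[OF refl] sum_ennreal[symmetric], simp)
  also have "\<dots> = (\<Sum>i<n. \<Sum>j<n. \<integral>\<^sup>+x. \<integral>\<^sup>+y. ennreal (?k i j) * (indicator (A i) x * indicator (A j) y) \<partial>\<nu> \<partial>\<nu>)"
  proof (intro sum.cong[OF refl])
    fix i j
    have "(\<integral>\<^sup>+y. ennreal (?k i j) * (indicator (A i) x * indicator (A j) y) \<partial>\<nu>)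
        = ennreal (?k i j) * ennreal (w j) * indicator (A i) x" for x
    proof -
      have "(\<integral>\<^sup>+y. ennreal (?k i j) * (indicator (A i) x * indicator (A j) y) \<partial>\<nu>)
        = (\<integral>\<^sup>+y. (ennreal (?k i j) * indicator (A i) x) * indicator (A j) y \<partial>\<nu>)"
        by (simp add: mult.assoc)
      also have "\<dots> = (ennreal (?k i j) * indicator (A i) x) * emeasure \<nu> (A j)"
        by (rule nn_integral_cmult_indicator) (simp add: sets_nu)
      finally show ?thesis by (simp add: w(2) ac_simps)
    qed
    then have "(\<integral>\<^sup>+x. \<integral>\<^sup>+y. ennreal (?k i j) * (indicator (A i) x * indicator (A j) y) \<partial>\<nu> \<partial>\<nu>)
      = (\<integral>\<^sup>+x. (ennreal (?k i j) * ennreal (w j)) * indicator (A i) x \<partial>\<nu>)" by simp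
    also have "\<dots> = (ennreal (?k i j) * ennreal (w j)) * emeasure \<nu> (A i)"
      by (rule nn_integral_cmult_indicator) (simp add: sets_nu)
    also have "\<dots> = ennreal (w i * w j * ?k i j)"
      using w(1) k by (simp add: w(2) ennreal_mult ac_simps)
    finally show "ennreal (w i * w j * ?k i j)
      = (\<integral>\<^sup>+x. \<integral>\<^sup>+y. ennreal (?k i j) * (indicator (A i) x * indicator (A j) y) \<partial>\<nu> \<partial>\<nu>)" by simp
  qed
  also have "\<dots> = (\<integral>\<^sup>+x. \<integral>\<^sup>+y. (\<Sum>i<n. \<Sum>j<n. ennreal (?k i j) * (indicator (A i) x * indicator (A j) y)) \<partial>\<nu> \<partial>\<nu>)"
    by (simp add: nn_integral_sum sets_nu)
  also have "\<dots> \<le> (\<integral>\<^sup>+x. \<integral>\<^sup>+y. ennreal (\<kappa> \<epsilon> \<bar>x - y\<bar>) + ennreal \<delta> \<partial>\<nu> \<partial>\<nu>)"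
  proof (intro nn_integral_mono)
    fix x y
    have "(\<Sum>i<n. \<Sum>j<n. ennreal (?k i j) * (indicator (A i) x * indicator (A j) y))
      \<le> (\<Sum>i<n. \<Sum>j<n. (ennreal (\<kappa> \<epsilon> \<bar>x - y\<bar>) + ennreal \<delta>) * (indicator (A i) x * indicator (A j) y))"
      by (intro sum_mono cell) auto
    also have "\<dots> = (ennreal (\<kappa> \<epsilon> \<bar>x - y\<bar>) + ennreal \<delta>) * (\<Sum>i<n. \<Sum>j<n. (indicator (A i) x * indicator (A j) y))"
      by (simp only: sum_distrib_left)
    also have "\<dots> \<le> (ennreal (\<kappa> \<epsilon> \<bar>x - y\<bar>) + ennreal \<delta>) * 1"
      by (intro mult_left_mono single) auto
    finally show "(\<Sum>i<n. \<Sum>j<n. ennreal (?k i j) * (indicator (A i) x * indicator (A j) y))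
      \<le> ennreal (\<kappa> \<epsilon> \<bar>x - y\<bar>) + ennreal \<delta>" by simp
  qed
  also have "\<dots> = (\<integral>\<^sup>+x. (\<integral>\<^sup>+y. ennreal (\<kappa> \<epsilon> \<bar>x - y\<bar>) \<partial>\<nu>) + ennreal \<delta> \<partial>\<nu>)"
    by (intro nn_integral_cong, subst nn_integral_add) (auto simp: \<nu>.emeasure_space_1)
  also have "\<dots> = (\<integral>\<^sup>+x. \<integral>\<^sup>+y. ennreal (\<kappa> \<epsilon> \<bar>x - y\<bar>) \<partial>\<nu> \<partial>\<nu>) + ennreal \<delta>"
    by (subst nn_integral_add) (auto simp: \<nu>.emeasure_space_1)
  finally show thesis
    using tN N(1) w(1) w1 by (intro that) auto
qed

text \<open>
  Along scales at which some measure has small energy, the random energy of its discretisation on \<open>D\<close>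
  is almost surely small, and its reciprocal bounds the separation number of \<open>X(D)\<close> from below.
  For the packing dimension \<open>D\<close> will be a countable dense subset of a set that need not be Borel.
\<close>

lemma AE_upper_minkowski_dim_ge:
  assumes F: "F \<in> sets borel" "F \<subseteq> closure D" and D: "bounded D" "D \<subseteq> {0..}"
    and q: "ereal q < box_dim_profile \<kappa> F"
  shows "AE \<omega> in M. ereal q \<le> upper_minkowski_dim ((\<lambda>t. X t \<omega>) ` D)"
proof (cases "q < 0")
  case True
  then have q0: "ereal q \<le> 0" by simp
  from AE_regular_path show ?thesis
  proof eventually_elim
    case (elim \<omega>)
    have "0 \<le> upper_minkowski_dim ((\<lambda>t. X t \<omega>) ` D)"
      by (intro upper_minkowski_dim_nonneg regular_path_bounded_image[OF elim D])
    with q0 show ?case by (rule order_trans)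
  qed
next
  case False
  from q obtain \<eta> where \<eta>: "\<eta> > 0" "q < \<eta>"
    and lim: "Liminf (at_right 0) (\<lambda>\<epsilon>. INF \<nu>\<in>borel_probs_on F. profile_energy \<kappa> \<eta> \<epsilon> \<nu>) = 0"
    using False unfolding box_dim_profile_def less_Sup_iff by auto
  define a :: "nat \<Rightarrow> real" where "a n = (1 / 2) ^ n" for n
  have a: "a n > 0" for n by (simp add: a_def)
  have "\<exists>\<epsilon>. 0 < \<epsilon> \<and> \<epsilon> < a n \<and> (\<exists>\<nu>\<in>borel_probs_on F. profile_energy \<kappa> \<eta> \<epsilon> \<nu> < ennreal (a n))" for n
  proof (rule ccontr)
    assume *: "\<not> (\<exists>\<epsilon>. 0 < \<epsilon> \<and> \<epsilon> < a n \<and> (\<exists>\<nu>\<in>borel_probs_on F. profile_energy \<kappa> \<eta> \<epsilon> \<nu> < ennreal (a n)))"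
    have "eventually (\<lambda>\<epsilon>. ennreal (a n) \<le> (INF \<nu>\<in>borel_probs_on F. profile_energy \<kappa> \<eta> \<epsilon> \<nu>)) (at_right 0)"
      using eventually_at_right_0_lt[OF a[of n]]
      by eventually_elim (use * in \<open>force intro!: INF_greatest simp: not_less\<close>)
    then have "ennreal (a n) \<le> 0" unfolding lim[symmetric] by (rule Liminf_bounded)
    then show False using a[of n] by (simp add: not_le[symmetric])
  qed
  then obtain \<epsilon> where "\<And>n. 0 < \<epsilon> n \<and> \<epsilon> n < a n \<and> (\<exists>\<nu>\<in>borel_probs_on F. profile_energy \<kappa> \<eta> (\<epsilon> n) \<nu> < ennreal (a n))"
    by metis
  then have eps: "0 < \<epsilon> n" "\<epsilon> n < a n"
    and ex: "\<exists>\<nu>\<in>borel_probs_on F. profile_energy \<kappa> \<eta> (\<epsilon> n) \<nu> < ennreal (a n)" for n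
    by blast+
  have "\<exists>N w t. (\<forall>i<N. t i \<in> D \<and> 0 \<le> w i) \<and> (\<Sum>i<N. w i) = 1 \<and>
      energy \<kappa> (\<epsilon> n / 2) N w t \<le> 2 * a n * \<epsilon> n powr \<eta>" for n
  proof -
    obtain \<nu> where \<nu>: "\<nu> \<in> borel_probs_on F" "profile_energy \<kappa> \<eta> (\<epsilon> n) \<nu> < ennreal (a n)"
      using ex by blast
    interpret \<nu>: prob_space \<nu> using \<nu>(1) by (simp add: borel_probs_on_def)
    have [measurable_cong]: "sets \<nu> = sets borel" using \<nu>(1) by (simp add: borel_probs_on_def)
    have ep: "\<epsilon> n powr \<eta> > 0" using eps(1)[of n] by simp
    have "(\<integral>\<^sup>+x. \<integral>\<^sup>+y. ennreal (\<kappa> (\<epsilon> n) \<bar>x - y\<bar>) \<partial>\<nu> \<partial>\<nu>)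
      = (\<integral>\<^sup>+x. \<integral>\<^sup>+y. ennreal (\<epsilon> n powr \<eta>) * ennreal (\<kappa> (\<epsilon> n) \<bar>x - y\<bar> / \<epsilon> n powr \<eta>) \<partial>\<nu> \<partial>\<nu>)"
      using ep kappa_nonneg by (simp flip: ennreal_mult)
    also have "\<dots> = ennreal (\<epsilon> n powr \<eta>) * profile_energy \<kappa> \<eta> (\<epsilon> n) \<nu>"
      by (simp add: nn_integral_cmult)
    also have "\<dots> \<le> ennreal (\<epsilon> n powr \<eta>) * ennreal (a n)"
      using \<nu>(2) by (intro mult_left_mono) auto
    finally have le: "(\<integral>\<^sup>+x. \<integral>\<^sup>+y. ennreal (\<kappa> (\<epsilon> n) \<bar>x - y\<bar>) \<partial>\<nu> \<partial>\<nu>) \<le> ennreal (\<epsilon> n powr \<eta> * a n)"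
      using ep a[of n] by (simp add: ennreal_mult)
    obtain N w t where t: "\<And>i. i < N \<Longrightarrow> t i \<in> D" "\<And>i. i < N \<Longrightarrow> 0 \<le> w i" "(\<Sum>i<N. w i) = 1"
      and en: "ennreal (energy \<kappa> (\<epsilon> n / 2) N w t)
        \<le> (\<integral>\<^sup>+x. \<integral>\<^sup>+y. ennreal (\<kappa> (\<epsilon> n) \<bar>x - y\<bar>) \<partial>\<nu> \<partial>\<nu>) + ennreal (\<epsilon> n powr \<eta> * a n)"
      using discretise_measure[OF \<nu>(1) F D eps(1)[of n], of "\<epsilon> n powr \<eta> * a n"] ep a[of n]
      by (metis mult_pos_pos)
    note en
    also have "(\<integral>\<^sup>+x. \<integral>\<^sup>+y. ennreal (\<kappa> (\<epsilon> n) \<bar>x - y\<bar>) \<partial>\<nu> \<partial>\<nu>) + ennreal (\<epsilon> n powr \<eta> * a n)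
      \<le> ennreal (\<epsilon> n powr \<eta> * a n) + ennreal (\<epsilon> n powr \<eta> * a n)"
      by (intro add_right_mono le)
    also have "\<dots> = ennreal (2 * a n * \<epsilon> n powr \<eta>)"
      using ep a[of n] by (simp flip: ennreal_plus)
    finally have "energy \<kappa> (\<epsilon> n / 2) N w t \<le> 2 * a n * \<epsilon> n powr \<eta>"
      using ep a[of n] by (subst (asm) ennreal_le_iff) auto
    with t show ?thesis by blast
  qed
  then obtain N w t where t: "\<And>n i. i < N n \<Longrightarrow> t n i \<in> D \<and> 0 \<le> w n i"
    and w: "\<And>n. (\<Sum>i<N n. w n i) = 1"
    and en: "\<And>n. energy \<kappa> (\<epsilon> n / 2) (N n) (w n) (t n) \<le> 2 * a n * \<epsilon> n powr \<eta>"
    by metis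
  have t0: "0 \<le> t n i" if "i < N n" for n i using t[OF that] D(2) by auto
  define I :: "nat \<Rightarrow> 'w \<Rightarrow> real" where "I n \<omega> = (\<Sum>i<N n. \<Sum>j<N n.
    w n i * w n j * indicator {v. infnorm v < \<epsilon> n / 2} (X (t n i) \<omega> - X (t n j) \<omega>))" for n \<omega>
  have I0: "0 \<le> I n \<omega>" for n \<omega>
    unfolding I_def using t by (intro sum_nonneg mult_nonneg_nonneg) auto
  have summand: "(\<lambda>\<omega>. w n i * w n j * indicator {v. infnorm v < \<epsilon> n / 2} (X (t n i) \<omega> - X (t n j) \<omega>) :: real)
      \<in> borel_measurable M" if "i < N n" "j < N n" for n i j
  proof -
    note [measurable] = measurable_X[OF t0[OF that(1)]] measurable_X[OF t0[OF that(2)]]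
    show ?thesis by measurable
  qed
  have I_meas [measurable]: "I n \<in> borel_measurable M" for n
    unfolding I_def by (intro borel_measurable_sum summand) auto
  have EI: "(\<integral>\<^sup>+\<omega>. ennreal (I n \<omega>) \<partial>M) = ennreal (energy \<kappa> (\<epsilon> n / 2) (N n) (w n) (t n))" for n
  proof -
    have ind: "expectation (\<lambda>\<omega>. indicator {v. infnorm v < \<epsilon> n / 2} (X (t n i) \<omega> - X (t n j) \<omega>))
        = \<kappa> (\<epsilon> n / 2) \<bar>t n i - t n j\<bar>"
      and int: "integrable M (\<lambda>\<omega>. indicator {v. infnorm v < \<epsilon> n / 2} (X (t n i) \<omega> - X (t n j) \<omega>) :: real)"
      if ij: "i < N n" "j < N n" for i j
    proof -
      let ?A = "{\<omega>\<in>space M. infnorm (X (t n i) \<omega> - X (t n j) \<omega>) < \<epsilon> n / 2}"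
      have A: "?A \<in> events" using t0 ij by (intro events_infnorm_increment)
      have eq: "indicator {v. infnorm v < \<epsilon> n / 2} (X (t n i) \<omega> - X (t n j) \<omega>) = (indicator ?A \<omega> :: real)"
        if "\<omega> \<in> space M" for \<omega> using that by (simp add: indicator_def)
      have "expectation (\<lambda>\<omega>. indicator {v. infnorm v < \<epsilon> n / 2} (X (t n i) \<omega> - X (t n j) \<omega>))
        = (expectation (indicator ?A) :: real)"
        by (rule Bochner_Integration.integral_cong[OF refl]) (rule eq)
      then show "expectation (\<lambda>\<omega>. indicator {v. infnorm v < \<epsilon> n / 2} (X (t n i) \<omega> - X (t n j) \<omega>))
        = \<kappa> (\<epsilon> n / 2) \<bar>t n i - t n j\<bar>"
        using A prob_increment[OF t0[OF ij(2)] t0[OF ij(1)], of "\<epsilon> n / 2"] by simp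
      have "integrable M (indicator ?A :: _ \<Rightarrow> real)" using A by (simp add: less_top[symmetric])
      then show "integrable M (\<lambda>\<omega>. indicator {v. infnorm v < \<epsilon> n / 2} (X (t n i) \<omega> - X (t n j) \<omega>) :: real)"
        by (rule Bochner_Integration.integrable_cong[THEN iffD2, rotated -1]) (simp_all only: eq)
    qed
    have Iint: "integrable M (I n)"
      unfolding I_def by (intro Bochner_Integration.integrable_sum integrable_mult_right int) auto
    have "expectation (I n) = (\<Sum>i<N n. \<Sum>j<N n. w n i * w n j *
        expectation (\<lambda>\<omega>. indicator {v. infnorm v < \<epsilon> n / 2} (X (t n i) \<omega> - X (t n j) \<omega>)))"
    proof -
      let ?J = "\<lambda>i j \<omega>. w n i * w n j * indicator {v. infnorm v < \<epsilon> n / 2} (X (t n i) \<omega> - X (t n j) \<omega>) :: real"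
      have J: "integrable M (?J i j)" if "i \<in> {..<N n}" "j \<in> {..<N n}" for i j
        using that by (intro integrable_mult_right int) auto
      have "expectation (I n) = (\<Sum>i<N n. expectation (\<lambda>\<omega>. \<Sum>j<N n. ?J i j \<omega>))"
        unfolding I_def by (intro Bochner_Integration.integral_sum Bochner_Integration.integrable_sum J)
      also have "\<dots> = (\<Sum>i<N n. \<Sum>j<N n. expectation (?J i j))"
        by (intro sum.cong[OF refl] Bochner_Integration.integral_sum J)
      finally show ?thesis by (simp only: integral_mult_right_zero)
    qed
    also have "\<dots> = energy \<kappa> (\<epsilon> n / 2) (N n) (w n) (t n)"
      unfolding energy_def by (intro sum.cong refl) (simp only: ind lessThan_iff)
    finally show ?thesis using Iint I0 by (simp add: nn_integral_eq_integral)
  qed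
  have "AE \<omega> in M. eventually (\<lambda>n. ennreal (I n \<omega> / \<epsilon> n powr \<eta>) \<le> 1) sequentially"
  proof (rule AE_eventually_le_1_of_summable)
    show "(\<lambda>\<omega>. ennreal (I n \<omega> / \<epsilon> n powr \<eta>)) \<in> borel_measurable M" for n by measurable
    show "0 \<le> 2 * a n" for n using a[of n] by simp
    show "summable (\<lambda>n. 2 * a n)" unfolding a_def by (intro summable_mult summable_geometric) simp
    show "(\<integral>\<^sup>+\<omega>. ennreal (I n \<omega> / \<epsilon> n powr \<eta>) \<partial>M) \<le> ennreal (2 * a n)" for n
    proof -
      have ep: "\<epsilon> n powr \<eta> > 0" using eps(1)[of n] by simp
      have "(\<integral>\<^sup>+\<omega>. ennreal (I n \<omega> / \<epsilon> n powr \<eta>) \<partial>M)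
        = (\<integral>\<^sup>+\<omega>. ennreal (1 / \<epsilon> n powr \<eta>) * ennreal (I n \<omega>) \<partial>M)"
        using ep I0 by (simp flip: ennreal_mult)
      also have "\<dots> = ennreal (1 / \<epsilon> n powr \<eta>) * ennreal (energy \<kappa> (\<epsilon> n / 2) (N n) (w n) (t n))"
        by (simp add: nn_integral_cmult EI)
      also have "\<dots> \<le> ennreal (1 / \<epsilon> n powr \<eta>) * ennreal (2 * a n * \<epsilon> n powr \<eta>)"
        by (intro mult_left_mono ennreal_leI en) auto
      also have "\<dots> = ennreal (2 * a n)" using ep a[of n] by (simp flip: ennreal_mult)
      finally show ?thesis .
    qed
  qed
  then show ?thesis using AE_regular_path
  proof eventually_elim
    case (elim \<omega>)
    let ?G = "(\<lambda>t. X t \<omega>) ` D"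
    have G: "bounded ?G" by (rule regular_path_bounded_image[OF elim(2) D])
    have "N 0 \<noteq> 0" using w[of 0] by (cases "N 0") auto
    then have "?G \<noteq> {}" using t[of 0 0] by auto
    \<comment> \<open>The discretised energy lives at radius \<open>\<epsilon> n / 2\<close>, hence controls separation at \<open>\<epsilon> n / 4\<close>.\<close>
    have "ereal \<eta> \<le> upper_minkowski_dim ?G"
    proof (rule upper_minkowski_dim_geI[OF G \<open>?G \<noteq> {}\<close>])
      show "(4::real) powr (- \<eta>) > 0" by simp
      show "\<epsilon> n / 4 > 0" for n using eps(1)[of n] by simp
      have "a \<longlonglongrightarrow> 0" unfolding a_def by (intro LIMSEQ_realpow_zero) auto
      then have "\<epsilon> \<longlonglongrightarrow> 0"
        by (rule tendsto_sandwich[rotated 3, OF _ _ _ tendsto_const]) (use eps in \<open>auto intro!: always_eventually less_imp_le\<close>)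
      then show "(\<lambda>n. \<epsilon> n / 4) \<longlonglongrightarrow> 0" by (rule tendsto_divide_zero)
      show "eventually (\<lambda>n. 4 powr (- \<eta>) * (\<epsilon> n / 4) powr (- \<eta>) \<le> real (separation_number ?G (\<epsilon> n / 4))) sequentially"
        using elim(1)
      proof eventually_elim
        case (elim n)
        have ep: "\<epsilon> n > 0" "\<epsilon> n powr \<eta> > 0" using eps(1)[of n] by simp_all
        have "I n \<omega> / \<epsilon> n powr \<eta> \<le> 1" using elim by (simp add: ennreal_le_1)
        then have le: "I n \<omega> \<le> \<epsilon> n powr \<eta>" using ep by (simp add: field_simps)
        have "1 \<le> real (separation_number ?G (\<epsilon> n / 4)) * I n \<omega>"
          using separation_number_energy_ge_1[OF G, of "\<epsilon> n / 4" "N n" "\<lambda>i. X (t n i) \<omega>" "w n"] t w ep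
          by (auto simp: I_def)
        also have "\<dots> \<le> real (separation_number ?G (\<epsilon> n / 4)) * \<epsilon> n powr \<eta>"
          by (intro mult_left_mono le) auto
        finally have "\<epsilon> n powr (- \<eta>) \<le> real (separation_number ?G (\<epsilon> n / 4))"
          using ep by (simp add: powr_minus field_simps)
        moreover have "4 powr (- \<eta>) * (\<epsilon> n / 4) powr (- \<eta>) = \<epsilon> n powr (- \<eta>)"
          using powr_mult[of 4 "\<epsilon> n / 4" "- \<eta>"] ep by simp
        ultimately show ?case by simp
      qed
    qed
    moreover have "ereal q \<le> ereal \<eta>" using \<eta>(2) by simp
    ultimately show ?case by (rule order_trans[rotated])
  qed
qed

end

section \<open>The upper bound for the Minkowski dimension\<close>

text \<open>
  Points that are isolated from the right must belong to \<open>D\<close>; each of them is the greatest point of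
  \<open>F\<close> below some rational number, so there are only countably many.
\<close>

lemma right_dense_countable_subset:
  fixes F :: "real set"
  obtains D where "D \<subseteq> F" "countable D" "\<And>t h. t \<in> F \<Longrightarrow> h > 0 \<Longrightarrow> \<exists>s\<in>D. t \<le> s \<and> s < t + h"
proof -
  define p where "p a b = (SOME s. s \<in> F \<inter> {a<..<b})" for a b :: real
  have p: "p a b \<in> F \<inter> {a<..<b}" if "s \<in> F" "a < s" "s < b" for a b s
    unfolding p_def by (rule someI[of _ s]) (use that in auto)
  define D where "D = F \<inter> ((\<lambda>(a, b). p a b) ` (\<rat> \<times> \<rat>) \<union> (\<lambda>q. Sup (F \<inter> {..<q})) ` \<rat>)"
  show thesis
  proof (rule that)
    show "D \<subseteq> F" by (auto simp: D_def)
    show "countable D" unfolding D_def by (intro countable_Int2 countable_Un countable_image countable_SIGMA countable_rat)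
    fix t h :: real assume t: "t \<in> F" "h > 0"
    show "\<exists>s\<in>D. t \<le> s \<and> s < t + h"
    proof (cases "\<exists>s\<in>F. t < s \<and> s < t + h")
      case True
      then obtain s where s: "s \<in> F" "t < s" "s < t + h" by auto
      obtain a where a: "a \<in> \<rat>" "t < a" "a < s" using Rats_dense_in_real[OF s(2)] by auto
      obtain b where b: "b \<in> \<rat>" "s < b" "b < t + h" using Rats_dense_in_real[OF s(3)] by auto
      have "p a b \<in> F \<inter> {a<..<b}" using p[OF s(1)] a b by auto
      then show ?thesis using a b by (intro bexI[of _ "p a b"]) (auto simp: D_def)
    next
      case False
      obtain q where q: "q \<in> \<rat>" "t < q" "q < t + h"
        using Rats_dense_in_real[of t "t + h"] t(2) by auto
      have "Sup (F \<inter> {..<q}) = t"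
        by (rule cSup_eq_maximum) (use t q False in force)+
      then have "t \<in> D" using t(1) q(1) by (auto simp: D_def intro!: image_eqI[of _ _ q])
      then show ?thesis using t by auto
    qed
  qed
qed

text \<open>
  For a right-continuous function, density from the right replaces density.
\<close>

lemma right_continuous_image_subset_closure:
  fixes f :: "real \<Rightarrow> 'a::metric_space"
  assumes "\<And>t. t \<in> F \<Longrightarrow> continuous (at_right t) f" and "D \<subseteq> F"
    and D: "\<And>t h. t \<in> F \<Longrightarrow> h > 0 \<Longrightarrow> \<exists>s\<in>D. t \<le> s \<and> s < t + h"
  shows "f ` F \<subseteq> closure (f ` D)"
proof
  fix y assume "y \<in> f ` F"
  then obtain t where t: "t \<in> F" "y = f t" by auto
  show "y \<in> closure (f ` D)"
    unfolding closure_approachable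
  proof (intro allI impI)
    fix e :: real assume "e > 0"
    have "(f \<longlongrightarrow> f t) (at_right t)" using assms(1)[OF t(1)] by (simp add: continuous_within)
    then have "eventually (\<lambda>s. dist (f s) (f t) < e) (at_right t)"
      using \<open>e > 0\<close> by (rule tendstoD)
    then obtain b where b: "b > t" "\<And>s. t < s \<Longrightarrow> s < b \<Longrightarrow> dist (f s) (f t) < e"
      by (auto simp: eventually_at_right_field)
    obtain s where "s \<in> D" "t \<le> s" "s < b" using D[OF t(1), of "b - t"] b(1) by auto
    then show "\<exists>z\<in>f ` D. dist z y < e"
      using b(2)[of s] t(2) \<open>e > 0\<close> by (intro bexI[of _ "f s"]) (cases "s = t", auto)
  qed
qed

text \<open>
  Time grids are nondecreasing sequences indexed by all natural numbers; a finite set is enumerated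
  by repeating its maximum.
\<close>

lemma finite_set_mono_enumeration:
  fixes S :: "real set"
  assumes "finite S" "S \<noteq> {}"
  obtains t where "mono t" "t ` {..<card S} = S" "range t = S"
proof -
  let ?l = "sorted_list_of_set S"
  let ?t = "\<lambda>i. ?l ! min i (card S - 1)"
  have c: "card S > 0" using assms by (simp add: card_gt_0_iff)
  have len: "length ?l = card S" by simp
  have set: "set ?l = S" using assms by simp
  have "mono ?t"
    by (rule monoI, rule sorted_nth_mono) (use c in auto)
  moreover have img: "?t ` {..<card S} = S"
  proof -
    have "?t ` {..<card S} = (\<lambda>i. ?l ! i) ` {..<length ?l}"
      unfolding len using c by (intro image_cong) auto
    also have "\<dots> = set ?l" by (auto simp: set_conv_nth)
    also note set
    finally show ?thesis .
  qed
  moreover have "range ?t \<subseteq> S"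
  proof (intro subsetI)
    fix x assume "x \<in> range ?t"
    then obtain i where "x = ?l ! min i (card S - 1)" by auto
    moreover have "min i (card S - 1) < length ?l" unfolding len using c by auto
    ultimately have "x \<in> set ?l" by (metis nth_mem)
    then show "x \<in> S" by (simp only: set)
  qed
  moreover have "S \<subseteq> range ?t" using img by (metis image_mono subset_UNIV)
  ultimately show thesis by (intro that[of ?t] equalityI[of "range ?t"])
qed

text \<open>
  Rational levels separate distinct extended reals, and there are only countably many of them.
\<close>

lemma AE_ereal_eqI:
  fixes B :: ereal
  assumes le: "\<And>q. B < ereal q \<Longrightarrow> AE x in M. U x \<le> ereal q"
    and ge: "\<And>q. ereal q < B \<Longrightarrow> AE x in M. ereal q \<le> U x"
  shows "AE x in M. U x = B"
proof -
  have "AE x in M. \<forall>q\<in>\<rat>. (B < ereal q \<longrightarrow> U x \<le> ereal q) \<and> (ereal q < B \<longrightarrow> ereal q \<le> U x)"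
    using le ge by (subst AE_ball_countable) (auto simp: countable_rat)
  then show ?thesis
  proof eventually_elim
    case (elim x)
    have rat: "\<exists>q\<in>\<rat>. a < ereal q \<and> ereal q < b" if ab: "a < b" for a b
    proof -
      obtain x where x: "a < ereal x" "ereal x < b" using ereal_dense2[OF ab] by auto
      obtain y where y: "ereal x < ereal y" "ereal y < b" using ereal_dense2[OF x(2)] by auto
      obtain z where "z \<in> \<rat>" "x < z" "z < y" using Rats_dense_in_real[of x y] y by auto
      then show ?thesis using x y
        by (intro bexI[of _ z]) (auto intro: less_trans[of a "ereal x"] less_trans[of _ "ereal y" b])
    qed
    show ?case
    proof (rule antisym; rule ccontr)
      assume "\<not> U x \<le> B"
      then obtain q where "q \<in> \<rat>" "B < ereal q" "ereal q < U x" using rat[of B "U x"] by (auto simp only: not_le)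
      then show False using elim by (auto simp: not_less[symmetric])
    next
      assume "\<not> B \<le> U x"
      then obtain q where "q \<in> \<rat>" "U x < ereal q" "ereal q < B" using rat[of "U x" B] by (auto simp only: not_le)
      then show False using elim by (auto simp: not_less[symmetric])
    qed
  qed
qed

context levy_process
begin

text \<open>
  The separation number of a countable right-dense set of times is dominated by the lower limit \<open>R k\<close>
  of the greedy numbers along finite subsets.  By Fatou's lemma its expectation is at most a constant
  times \<open>e k powr (- \<eta>)\<close>; the gap between \<open>\<eta>\<close> and \<open>q\<close> makes \<open>e k powr q * R k\<close> summable in
  expectation along geometric scales \<open>e k\<close>.
\<close>

lemma AE_upper_minkowski_dim_le:
  assumes F: "F \<in> sets borel" "bounded F" "F \<subseteq> {0..}"
    and q: "box_dim_profile \<kappa> F < ereal q"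
  shows "AE \<omega> in M. upper_minkowski_dim ((\<lambda>t. X t \<omega>) ` F) \<le> ereal q"
proof (cases "F = {}")
  case True
  have "0 \<le> box_dim_profile \<kappa> F" unfolding box_dim_profile_def by (rule Sup_upper) simp
  then have "0 \<le> ereal q" using q by (meson less_imp_le order_trans)
  then show ?thesis using True by (simp add: upper_minkowski_dim_def)
next
  case False
  have nn: "0 \<le> box_dim_profile \<kappa> F" unfolding box_dim_profile_def by (rule Sup_upper) simp
  obtain \<eta> where \<eta>: "box_dim_profile \<kappa> F < ereal \<eta>" "ereal \<eta> < ereal q"
    using ereal_dense2[OF q] by auto
  then have eta: "0 < \<eta>" "\<eta> < q" using nn by (auto dest: le_less_trans)
  let ?\<Phi> = "\<lambda>\<epsilon>. INF \<nu>\<in>borel_probs_on F. profile_energy \<kappa> \<eta> \<epsilon> \<nu>"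
  have "Liminf (at_right 0) ?\<Phi> \<noteq> 0"
  proof
    assume "Liminf (at_right 0) ?\<Phi> = 0"
    then have "ereal \<eta> \<le> box_dim_profile \<kappa> F"
      unfolding box_dim_profile_def using eta by (intro Sup_upper) auto
    then show False using \<eta>(1) by simp
  qed
  then have "0 < Liminf (at_right 0) ?\<Phi>" by (simp add: zero_less_iff_neq_zero)
  then obtain x where x: "0 < x" "x < Liminf (at_right 0) ?\<Phi>" using dense by blast
  then have "x \<noteq> top" by (auto dest: less_imp_neq simp: top.not_eq_extremum[symmetric] less_top[symmetric])
  then obtain c where "x = ennreal c" "c \<ge> 0" by (cases x) auto
  with x have c: "0 < c" "ennreal c < Liminf (at_right 0) ?\<Phi>" by auto
  have "eventually (\<lambda>\<epsilon>. ennreal c < ?\<Phi> \<epsilon>) (at_right 0)" by (rule less_LiminfD[OF c(2)])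
  then obtain \<epsilon>0 where \<epsilon>0: "\<epsilon>0 > 0" "\<And>\<epsilon>. 0 < \<epsilon> \<Longrightarrow> \<epsilon> < \<epsilon>0 \<Longrightarrow> ennreal c < ?\<Phi> \<epsilon>"
    by (auto simp: eventually_at_right_field)
  \<comment> \<open>All scales \<open>e k\<close> lie below \<open>\<epsilon>0\<close>, where the lower bound for the energies is valid.\<close>
  obtain k0 :: nat where k0: "(1/2) ^ k0 < \<epsilon>0"
    using real_arch_pow_inv[OF \<epsilon>0(1), of "1/2"] by auto
  define e :: "nat \<Rightarrow> real" where "e k = (1/2) ^ k * (1/2) ^ k0" for k
  have e: "e k > 0" "e k < \<epsilon>0" for k
  proof -
    show "e k > 0" by (simp add: e_def)
    have "e k \<le> 1 * (1/2) ^ k0" unfolding e_def by (intro mult_right_mono power_le_one) auto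
    then show "e k < \<epsilon>0" using k0 by simp
  qed
  obtain D where D: "D \<subseteq> F" "countable D" "\<And>t h. t \<in> F \<Longrightarrow> h > 0 \<Longrightarrow> \<exists>s\<in>D. t \<le> s \<and> s < t + h"
    using right_dense_countable_subset by blast
  have "D \<noteq> {}" using D(3)[of _ 1] False by auto
  define d where "d = from_nat_into D"
  have d: "range d = D" unfolding d_def using D(2) \<open>D \<noteq> {}\<close> by (simp add: range_from_nat_into)
  have "\<exists>t. mono t \<and> t ` {..<card (d ` {..m})} = d ` {..m} \<and> range t = d ` {..m}" for m :: nat
    by (rule finite_set_mono_enumeration[of "d ` {..m}"]) auto
  then obtain t where t: "\<And>m. mono (t m)" "\<And>m. t m ` {..<card (d ` {..m})} = d ` {..m}"
    "\<And>m. range (t m) = d ` {..m}" by metis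
  have tF: "t m i \<in> F" for m i using t(3)[of m] d D(1) by blast
  have t0: "0 \<le> t m i" for m i using tF[of m i] F(3) by auto
  define G where "G k m \<omega> = greedy (2 * e k) (\<lambda>i. X (t m i) \<omega>) (card (d ` {..m}))" for k m \<omega>
  define R where "R k \<omega> = liminf (\<lambda>m. ennreal (card (G k m \<omega>)))" for k \<omega>
  have G_meas [measurable]: "(\<lambda>\<omega>. real (card (G k m \<omega>))) \<in> borel_measurable M" for k m
  proof -
    have [measurable]: "Measurable.pred M (\<lambda>\<omega>. i \<in> G k m \<omega>)" for i
      unfolding G_def by (intro pred_greedy measurable_X t0)
    have "card (G k m \<omega>) = (\<Sum>i<card (d ` {..m}). if i \<in> G k m \<omega> then 1 else 0)" for \<omega>
    proof -
      have "{..<card (d ` {..m})} \<inter> G k m \<omega> = G k m \<omega>"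
        unfolding G_def using greedy_subset by auto
      then show ?thesis by (simp add: sum.If_cases)
    qed
    then have "(\<lambda>\<omega>. real (card (G k m \<omega>))) = (\<lambda>\<omega>. real (\<Sum>i<card (d ` {..m}). if i \<in> G k m \<omega> then 1 else 0))"
      by simp
    also have "\<dots> \<in> borel_measurable M" by measurable
    finally show ?thesis .
  qed
  have R_meas [measurable]: "R k \<in> borel_measurable M" for k
    unfolding R_def by measurable
  have ER: "(\<integral>\<^sup>+\<omega>. R k \<omega> \<partial>M) \<le> ennreal (2 / (c * e k powr \<eta>))" for k
  proof -
    have "(\<integral>\<^sup>+\<omega>. R k \<omega> \<partial>M) \<le> liminf (\<lambda>m. \<integral>\<^sup>+\<omega>. ennreal (card (G k m \<omega>)) \<partial>M)"
      unfolding R_def by (rule nn_integral_liminf) simp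
    also have "\<dots> \<le> liminf (\<lambda>m. ennreal (2 / (c * e k powr \<eta>)))"
      unfolding G_def
      by (intro Liminf_mono always_eventually allI expected_greedy_le[OF t(1) t0 tF F(1) e(1) c(1)])
        (use \<epsilon>0(2)[OF e, THEN less_imp_le] in auto)
    also have "\<dots> = ennreal (2 / (c * e k powr \<eta>))" by (simp add: Liminf_const)
    finally show ?thesis .
  qed
  have "AE \<omega> in M. eventually (\<lambda>k. ennreal (e k powr q) * R k \<omega> \<le> 1) sequentially"
  proof (rule AE_eventually_le_1_of_summable)
    show "(\<lambda>\<omega>. ennreal (e k powr q) * R k \<omega>) \<in> borel_measurable M" for k by measurable
    let ?b = "\<lambda>k. 2 / c * ((1/2) ^ k0) powr (q - \<eta>) * ((1/2) powr (q - \<eta>)) ^ k"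
    show "0 \<le> ?b k" for k using c(1) by simp
    have "(1/2) powr (q - \<eta>) < 1" using eta(2) by (simp add: powr01_less_one)
    then show "summable ?b" by (intro summable_mult summable_geometric) simp
    show "(\<integral>\<^sup>+\<omega>. ennreal (e k powr q) * R k \<omega> \<partial>M) \<le> ennreal (?b k)" for k
    proof -
      have "(\<integral>\<^sup>+\<omega>. ennreal (e k powr q) * R k \<omega> \<partial>M) = ennreal (e k powr q) * (\<integral>\<^sup>+\<omega>. R k \<omega> \<partial>M)"
        by (rule nn_integral_cmult) simp
      also have "\<dots> \<le> ennreal (e k powr q) * ennreal (2 / (c * e k powr \<eta>))"
        by (intro mult_left_mono ER) auto
      also have "\<dots> = ennreal (e k powr q * (2 / (c * e k powr \<eta>)))"
        using c(1) by (intro ennreal_mult[symmetric]) auto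
      also have "e k powr q * (2 / (c * e k powr \<eta>)) = 2 / c * e k powr (q - \<eta>)"
        by (simp add: powr_diff)
      also have "e k powr (q - \<eta>) = ((1/2) powr (q - \<eta>)) ^ k * ((1/2) ^ k0) powr (q - \<eta>)"
      proof -
        have "((1/2::real) ^ k) powr (q - \<eta>) = ((1/2) powr (q - \<eta>)) ^ k"
          by (simp add: powr_powr mult.commute flip: powr_realpow)
        then show ?thesis unfolding e_def by (simp only: powr_mult)
      qed
      finally show ?thesis by (simp add: mult.commute mult.left_commute)
    qed
  qed
  then show ?thesis using AE_regular_path
  proof eventually_elim
    case (elim \<omega>)
    let ?D = "(\<lambda>t. X t \<omega>) ` D"
    have bF: "bounded ((\<lambda>t. X t \<omega>) ` F)" by (rule regular_path_bounded_image[OF elim(2) F(2,3)])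
    have bD: "bounded ?D" using bF D(1) by (meson bounded_subset image_mono)
    have K: "of_nat (separation_number ?D (4 * e k)) \<le> R k \<omega>" for k
    proof -
      obtain S where S: "finite S" "S \<subseteq> ?D" "separated (4 * e k) S" "card S = separation_number ?D (4 * e k)"
        using separation_number_attained[OF bD, of "4 * e k"] e(1)[of k] by auto
      obtain T where T: "finite T" "T \<subseteq> D" "S = (\<lambda>t. X t \<omega>) ` T"
        using finite_subset_image[OF S(1,2)] by auto
      obtain I where I: "finite I" "T = d ` I"
        using finite_subset_image[of T d UNIV] T d by auto
      have "eventually (\<lambda>m. of_nat (card S) \<le> ennreal (card (G k m \<omega>))) sequentially"
        unfolding eventually_sequentially
      proof (intro exI allI impI)
        fix m assume m: "Max (insert 0 I) \<le> m"
        have "T \<subseteq> d ` {..m}" using I m Max_ge[of "insert 0 I"] by (fastforce intro: order_trans)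
        then have "S \<subseteq> (\<lambda>t. X t \<omega>) ` t m ` {..<card (d ` {..m})}"
          unfolding T(3) t(2) by (rule image_mono)
        then have "S \<subseteq> (\<lambda>i. X (t m i) \<omega>) ` {..<card (d ` {..m})}"
          by (simp only: image_image)
        then have "card S \<le> card (G k m \<omega>)"
          unfolding G_def using S(3) e(1)[of k] by (intro separated_card_le_greedy) auto
        then show "of_nat (card S) \<le> ennreal (card (G k m \<omega>))"
          by (simp add: ennreal_of_nat_eq_real_of_nat)
      qed
      then show ?thesis unfolding R_def S(4)[symmetric] by (rule Liminf_bounded)
    qed
    obtain k1 where k1: "\<And>k. k \<ge> k1 \<Longrightarrow> ennreal (e k powr q) * R k \<omega> \<le> 1"
      using elim(1) by (auto simp: eventually_sequentially)
    have Kk: "real (separation_number ?D (4 * e k)) \<le> e k powr (- q)" if "k \<ge> k1" for k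
    proof -
      have "ennreal (e k powr q * real (separation_number ?D (4 * e k)))
        = ennreal (e k powr q) * of_nat (separation_number ?D (4 * e k))"
        by (simp add: ennreal_mult ennreal_of_nat_eq_real_of_nat)
      also have "\<dots> \<le> ennreal (e k powr q) * R k \<omega>" by (intro mult_left_mono K) auto
      also have "\<dots> \<le> 1" by (rule k1[OF that])
      finally have "e k powr q * real (separation_number ?D (4 * e k)) \<le> 1" by (simp add: ennreal_le_1)
      then show ?thesis using e(1)[of k] by (simp add: powr_minus field_simps)
    qed
    have "upper_minkowski_dim ?D \<le> ereal q"
    proof (rule upper_minkowski_dim_leI[OF bD])
      show "(8::real) powr q > 0" "q \<ge> 0" using eta by auto
      show "eventually (\<lambda>r. real (separation_number ?D r) \<le> 8 powr q * r powr (- q)) (at_right 0)"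
        using eventually_at_right_0_lt[of "4 * e k1", OF mult_pos_pos[OF zero_less_numeral e(1)[of k1]]]
      proof eventually_elim
        case (elim r)
        then have r: "0 < r" "r < 4 * e k1" by auto
        \<comment> \<open>\<open>k\<close> is the scale with \<open>4 * e k \<le> r < 8 * e k\<close>\<close>
        define k where "k = (LEAST k. 4 * e k \<le> r)"
        obtain k' where "(1/2) ^ k' < r / 4 / (1/2) ^ k0"
          using real_arch_pow_inv[of "r / 4 / (1/2) ^ k0" "1/2"] r by auto
        then have "4 * e k' \<le> r" by (simp add: e_def field_simps)
        then have k: "4 * e k \<le> r" unfolding k_def by (rule LeastI)
        have dec: "e j \<le> e i" if "i \<le> j" for i j
          unfolding e_def using that by (intro mult_right_mono power_decreasing) auto
        have "k > k1"
        proof (rule ccontr)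
          assume "\<not> k > k1"
          then show False using dec[of k k1] k r by simp
        qed
        then obtain j where j: "k = Suc j" by (cases k) auto
        have "\<not> 4 * e j \<le> r" using not_less_Least[of j "\<lambda>k. 4 * e k \<le> r"] j unfolding k_def by auto
        moreover have "e j = 2 * e k" by (simp add: e_def j)
        ultimately have r8: "r / 8 \<le> e k" by simp
        have "real (separation_number ?D r) \<le> real (separation_number ?D (4 * e k))"
          using separation_number_antimono_radius[OF bD _ k] e(1)[of k] by simp
        also have "\<dots> \<le> e k powr (- q)" using Kk[of k] \<open>k > k1\<close> by simp
        also have "\<dots> \<le> (r / 8) powr (- q)" using r8 r eta by (intro powr_mono2') auto
        also have "\<dots> = 8 powr q * r powr (- q)" using r by (simp add: powr_divide powr_minus field_simps)
        finally show ?case .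
      qed
    qed
    moreover have "upper_minkowski_dim ((\<lambda>t. X t \<omega>) ` F) \<le> upper_minkowski_dim ?D"
      using elim(2) F(3)
      by (intro upper_minkowski_dim_subset_closure bD right_continuous_image_subset_closure D)
        (auto simp: regular_path_def)
    ultimately show ?case by (rule order_trans[rotated])
  qed
qed

lemma AE_upper_minkowski_dim_eq:
  assumes F: "F \<in> sets borel" "bounded F" "F \<subseteq> {0..}"
  shows "AE \<omega> in M. upper_minkowski_dim ((\<lambda>t. X t \<omega>) ` F) = box_dim_profile \<kappa> F"
  using AE_upper_minkowski_dim_le[OF F] AE_upper_minkowski_dim_ge[OF F(1) closure_subset F(2,3)]
  by (rule AE_ereal_eqI)

end

section \<open>Borel sets as projections of closed sets\<close>

text \<open>
  The analytic sets, as projections of closed sets: in this form closedness under countable unions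
  and intersections is a matter of recoding the parameter, and the closed set above is itself a
  complete metric space.
\<close>

definition souslin :: "real set \<Rightarrow> bool" where
  "souslin A \<longleftrightarrow>
    (\<exists>C :: ((nat \<Rightarrow> nat discrete) \<times> real) set. closed C \<and> (\<forall>y. y \<in> A \<longleftrightarrow> (\<exists>x. (x, y) \<in> C)))"

lemma souslinI:
  assumes "closed C" "\<And>y. y \<in> A \<longleftrightarrow> (\<exists>x :: nat \<Rightarrow> nat discrete. (x, y) \<in> C)"
  shows "souslin A"
  unfolding souslin_def using assms by blast

lemma souslin_closed: "closed A \<Longrightarrow> souslin A"
  by (rule souslinI[of "UNIV \<times> A"]) (auto intro: closed_Times)

lemma continuous_on_parameter_coordinate:
  "continuous_on UNIV (\<lambda>p :: (nat \<Rightarrow> nat discrete) \<times> real. fst p k)"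
  by (rule continuous_on_product_then_coordinatewise) (intro continuous_on_fst continuous_on_id)

lemma souslin_UN:
  assumes "\<And>n::nat. souslin (A n)"
  shows "souslin (\<Union>n. A n)"
proof -
  obtain C :: "nat \<Rightarrow> ((nat \<Rightarrow> nat discrete) \<times> real) set"
    where C: "\<And>n. closed (C n)" "\<And>n y. y \<in> A n \<longleftrightarrow> (\<exists>x. (x, y) \<in> C n)"
    using assms unfolding souslin_def by metis
  let ?f = "\<lambda>p :: (nat \<Rightarrow> nat discrete) \<times> real. ((\<lambda>m. fst p (Suc m)), snd p)"
  let ?h = "\<lambda>p :: (nat \<Rightarrow> nat discrete) \<times> real. fst p 0"
  \<comment> \<open>The first coordinate of the parameter selects the set of the union.\<close>
  let ?C = "{p. ?f p \<in> C (of_discrete (?h p))}"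
  have f: "continuous_on UNIV ?f"
    by (intro continuous_on_Pair continuous_on_coordinatewise_then_product
        continuous_on_parameter_coordinate continuous_on_snd continuous_on_id)
  have h: "continuous_on UNIV ?h"
    by (rule continuous_on_parameter_coordinate)
  have eq: "- ?C = (\<Union>n. ?h -` {discrete n} \<inter> ?f -` (- C n))"
  proof (intro equalityI subsetI)
    fix p assume "p \<in> - ?C"
    then show "p \<in> (\<Union>n. ?h -` {discrete n} \<inter> ?f -` (- C n))"
      by (intro UN_I[of "of_discrete (?h p)"]) (auto simp: of_discrete_inverse)
  qed (auto simp: discrete_inverse)
  have op: "open (?h -` {discrete n} \<inter> ?f -` (- C n))" for n
  proof (rule open_Int)
    show "open (?h -` {discrete n})" by (rule open_vimage[OF open_discrete h])
    show "open (?f -` (- C n))" by (rule open_vimage[OF open_Compl[OF C(1)] f])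
  qed
  have "open (- ?C)" unfolding eq by (intro open_UN ballI op)
  then have "closed ?C" by (simp only: closed_def)
  then show ?thesis
  proof (rule souslinI)
    fix y
    show "y \<in> (\<Union>n. A n) \<longleftrightarrow> (\<exists>x. (x, y) \<in> ?C)"
    proof
      assume "y \<in> (\<Union>n. A n)"
      then obtain n x where "(x, y) \<in> C n" using C(2) by auto
      then have "(case_nat (discrete n) x, y) \<in> ?C" by (simp add: discrete_inverse)
      then show "\<exists>x. (x, y) \<in> ?C" by blast
    next
      assume "\<exists>x. (x, y) \<in> ?C"
      then obtain x where "((\<lambda>m. x (Suc m)), y) \<in> C (of_discrete (x 0))" by auto
      then have "y \<in> A (of_discrete (x 0))" using C(2) by blast
      then show "y \<in> (\<Union>n. A n)" by blast
    qed
  qed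
qed

lemma souslin_INT:
  assumes "\<And>n::nat. souslin (A n)"
  shows "souslin (\<Inter>n. A n)"
proof -
  obtain C :: "nat \<Rightarrow> ((nat \<Rightarrow> nat discrete) \<times> real) set"
    where C: "\<And>n. closed (C n)" "\<And>n y. y \<in> A n \<longleftrightarrow> (\<exists>x. (x, y) \<in> C n)"
    using assms unfolding souslin_def by metis
  \<comment> \<open>One parameter codes a sequence of parameters through the pairing of natural numbers.\<close>
  let ?f = "\<lambda>n (p :: (nat \<Rightarrow> nat discrete) \<times> real). ((\<lambda>m. fst p (prod_encode (n, m))), snd p)"
  have f: "continuous_on UNIV (?f n)" for n
    by (intro continuous_on_Pair continuous_on_coordinatewise_then_product
        continuous_on_parameter_coordinate continuous_on_snd continuous_on_id)
  have "closed (\<Inter>n. ?f n -` C n)" by (intro closed_INT ballI closed_vimage f C(1))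
  then show ?thesis
  proof (rule souslinI)
    fix y
    show "y \<in> (\<Inter>n. A n) \<longleftrightarrow> (\<exists>x. (x, y) \<in> (\<Inter>n. ?f n -` C n))"
    proof
      assume "y \<in> (\<Inter>n. A n)"
      then have "\<forall>n. \<exists>x. (x, y) \<in> C n" using C(2) by auto
      then obtain x where x: "\<And>n. (x n, y) \<in> C n" by metis
      let ?x = "\<lambda>k. x (fst (prod_decode k)) (snd (prod_decode k))"
      have "(\<lambda>m. ?x (prod_encode (n, m))) = x n" for n by simp
      then have "(?x, y) \<in> (\<Inter>n. ?f n -` C n)" using x by simp
      then show "\<exists>x. (x, y) \<in> (\<Inter>n. ?f n -` C n)" by blast
    qed (use C(2) in auto)
  qed
qed

lemma souslin_open:
  assumes "open (U :: real set)" shows "souslin U"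
proof -
  have "fsigma_in euclidean U"
    using assms by (metis open_imp_fsigma_in open_openin metrizable_space_euclidean)
  then obtain C where C: "\<And>n. closed (C n)" "(\<Union>n::nat. C n) = U"
    by (auto simp: fsigma_in_ascending)
  show ?thesis unfolding C(2)[symmetric] by (intro souslin_UN souslin_closed C(1))
qed

text \<open>
  Complements of Souslin sets need not be Souslin, so the induction carries the complement along.
\<close>

lemma souslin_borel:
  assumes "A \<in> sets (borel :: real measure)" shows "souslin A"
proof -
  have "A \<in> sigma_sets UNIV {S. open S}" using assms by (simp add: sets_borel)
  then have "souslin A \<and> souslin (- A)"
  proof induction
    case (Basic U)
    then show ?case by (auto intro: souslin_open souslin_closed simp: closed_Compl)
  next
    case Empty
    then show ?case by (simp add: souslin_closed)
  next
    case (Compl A)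
    then show ?case by (simp add: Compl_eq_Diff_UNIV[symmetric])
  next
    case (Union A)
    then have "souslin (\<Inter>n. - A n)" by (intro souslin_INT) auto
    with Union show ?case by (auto intro: souslin_UN simp: Compl_UN)
  qed
  then show ?thesis ..
qed

section \<open>A category argument\<close>

text \<open>
  Delete from a closed set of the Polish space above \<open>F\<close> all basic open sets whose projection lies
  in the ideal.  What remains is a nonempty Baire space, each nonempty open piece of which projects
  outside of the ideal; by Baire's theorem a countable closed cover of \<open>F\<close> has a member that
  contains one of these projections.
\<close>

lemma souslin_category:
  assumes F: "souslin F" "F \<notin> \<I>"
    and sub: "\<And>A B. A \<in> \<I> \<Longrightarrow> B \<subseteq> A \<Longrightarrow> B \<in> \<I>"
    and UN: "\<And>A. (\<And>n::nat. A n \<in> \<I>) \<Longrightarrow> (\<Union>n. A n) \<in> \<I>" and empty: "{} \<in> \<I>"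
  obtains \<E> where "countable \<E>" "\<forall>E\<in>\<E>. E \<subseteq> F \<and> E \<notin> \<I>"
    "\<forall>K. (\<forall>n::nat. closed (K n)) \<longrightarrow> F \<subseteq> (\<Union>n. K n) \<longrightarrow> (\<exists>n. \<exists>E\<in>\<E>. E \<subseteq> K n)"
proof -
  obtain C :: "((nat \<Rightarrow> nat discrete) \<times> real) set"
    where C: "closed C" "\<And>y. y \<in> F \<longleftrightarrow> (\<exists>x. (x, y) \<in> C)" using F(1) unfolding souslin_def by blast
  have CF: "snd ` C = F" using C(2) by force
  have UNc: "\<Union>\<A> \<in> \<I>" if "countable \<A>" "\<A> \<subseteq> \<I>" for \<A>
  proof (cases "\<A> = {}")
    case False
    then show ?thesis
      using UN[of "from_nat_into \<A>"] that range_from_nat_into[OF False that(1)] from_nat_into[OF False]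
      by (metis subsetD)
  qed (simp add: empty)
  have Un: "A \<union> B \<in> \<I>" if "A \<in> \<I>" "B \<in> \<I>" for A B
    using UNc[of "{A, B}"] that by simp
  obtain \<B> :: "((nat \<Rightarrow> nat discrete) \<times> real) set set" where \<B>: "countable \<B>" "topological_basis \<B>"
    using ex_countable_basis by blast
  let ?small = "{V \<in> \<B>. snd ` (V \<inter> C) \<in> \<I>}"
  define C' where "C' = C - \<Union>?small"
  have "open (\<Union>?small)" using topological_basis_open[OF \<B>(2)] by blast
  then have closed: "closed C'" unfolding C'_def using C(1) by (simp add: closed_Diff)
  have removed: "(\<Union>V\<in>?small. snd ` (V \<inter> C)) \<in> \<I>"
    by (intro UNc countable_image) (auto intro: countable_subset[OF _ \<B>(1)])
  have big: "snd ` (V \<inter> C') \<notin> \<I>" if V: "V \<in> \<B>" "V \<inter> C' \<noteq> {}" for V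
  proof
    assume "snd ` (V \<inter> C') \<in> \<I>"
    then have "snd ` (V \<inter> C') \<union> (\<Union>V\<in>?small. snd ` (V \<inter> C)) \<in> \<I>" using removed by (rule Un)
    moreover have "snd ` (V \<inter> C) \<subseteq> snd ` (V \<inter> C') \<union> (\<Union>V\<in>?small. snd ` (V \<inter> C))"
      unfolding C'_def by blast
    ultimately have "snd ` (V \<inter> C) \<in> \<I>" by (rule sub)
    then show False using V unfolding C'_def by blast
  qed
  have "C' \<noteq> {}"
  proof
    assume "C' = {}"
    then have "F \<subseteq> (\<Union>V\<in>?small. snd ` (V \<inter> C))" unfolding CF[symmetric] C'_def by blast
    then show False using sub[OF removed] F(2) by blast
  qed
  let ?\<E> = "{snd ` (V \<inter> C') |V. V \<in> \<B> \<and> V \<inter> C' \<noteq> {}}"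
  show thesis
  proof (rule that[of ?\<E>], goal_cases)
    case 1
    have "?\<E> \<subseteq> (\<lambda>V. snd ` (V \<inter> C')) ` \<B>" by blast
    then show ?case by (rule countable_subset) (rule countable_image[OF \<B>(1)])
  next
    case 2
    show ?case
    proof
      fix E assume "E \<in> ?\<E>"
      then obtain V where V: "V \<in> \<B>" "V \<inter> C' \<noteq> {}" "E = snd ` (V \<inter> C')" by blast
      have "C' \<subseteq> C" unfolding C'_def by blast
      then have "E \<subseteq> snd ` C" unfolding V(3) by blast
      with big[OF V(1,2)] show "E \<subseteq> F \<and> E \<notin> \<I>" unfolding V(3) CF by blast
    qed
  next
    case 3
    show ?case
    proof (intro allI impI)
      fix K :: "nat \<Rightarrow> real set"
      assume K': "\<forall>n. closed (K n)" and K: "F \<subseteq> (\<Union>n. K n)"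
      let ?X = "top_of_set C'"
      let ?G = "\<lambda>n. C' \<inter> snd -` K n"
      show "\<exists>n. \<exists>E\<in>?\<E>. E \<subseteq> K n"
      proof (rule ccontr)
        assume not: "\<not> ?thesis"
        have "?X interior_of \<Union>(range ?G) = {}"
        proof (rule Baire_category_alt)
          show "completely_metrizable_space ?X \<or> locally_compact_space ?X \<and> regular_space ?X"
            using closed by (simp add: completely_metrizable_space_closedin completely_metrizable_space_euclidean)
          show "countable (range ?G)" by simp
          fix T assume "T \<in> range ?G"
          then obtain n where T: "T = ?G n" by auto
          have "closed (snd -` K n :: ((nat \<Rightarrow> nat discrete) \<times> real) set)"
            by (intro closed_vimage K'[rule_format] continuous_on_snd continuous_on_id)
          then have cl: "closedin ?X T" unfolding T by (auto simp: closedin_closed)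
          have int: "?X interior_of T = {}"
          proof (rule ccontr)
            assume "?X interior_of T \<noteq> {}"
            then obtain p where "p \<in> ?X interior_of T" by auto
            then obtain U where U: "open U" "p \<in> U \<inter> C'" "U \<inter> C' \<subseteq> T"
              by (auto simp: interior_of_def openin_open Int_commute)
            then obtain V where V: "V \<in> \<B>" "p \<in> V" "V \<subseteq> U"
              using topological_basisE[OF \<B>(2) U(1)] by blast
            have "snd ` (V \<inter> C') \<subseteq> K n" using U V T by blast
            moreover have "snd ` (V \<inter> C') \<in> ?\<E>" using U V by blast
            ultimately show False using not by blast
          qed
          show "closedin ?X T \<and> ?X interior_of T = {}" using cl int ..
        qed
        moreover have "\<Union>(range ?G) = topspace ?X"
        proof (intro equalityI subsetI)
          fix p assume "p \<in> topspace ?X"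
          then have p: "p \<in> C'" by simp
          then have "snd p \<in> F" unfolding CF[symmetric] C'_def by blast
          then show "p \<in> \<Union>(range ?G)" using K p by auto
        qed simp
        ultimately have "topspace ?X = {}" by (simp only: interior_of_topspace)
        then show False using \<open>C' \<noteq> {}\<close> by simp
      qed
    qed
  qed
qed

section \<open>The packing dimension\<close>

lemma box_dim_profile_mono:
  assumes "A \<in> sets borel" "B \<in> sets borel" "A \<subseteq> B"
  shows "box_dim_profile \<kappa> A \<le> box_dim_profile \<kappa> B"
proof -
  have sub: "borel_probs_on A \<subseteq> borel_probs_on B"
  proof
    fix \<nu> assume \<nu>: "\<nu> \<in> borel_probs_on A"
    then interpret prob_space \<nu> by (simp add: borel_probs_on_def)
    have "emeasure \<nu> A \<le> emeasure \<nu> B"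
      using \<nu> assms by (intro emeasure_mono) (auto simp: borel_probs_on_def)
    then have "emeasure \<nu> B = 1"
      using \<nu> emeasure_le_1[of B] by (auto simp: borel_probs_on_def intro: antisym)
    then show "\<nu> \<in> borel_probs_on B" using \<nu> by (simp add: borel_probs_on_def)
  qed
  let ?L = "\<lambda>\<eta> A. Liminf (at_right 0) (\<lambda>\<epsilon>. INF \<nu>\<in>borel_probs_on A. profile_energy \<kappa> \<eta> \<epsilon> \<nu>)"
  have le: "?L \<eta> B \<le> ?L \<eta> A" for \<eta>
    by (intro Liminf_mono always_eventually allI INF_superset_mono sub order_refl)
  have zero: "?L \<eta> B = 0" if "?L \<eta> A = 0" for \<eta>
    using le[of \<eta>] unfolding that by (simp only: le_zero_eq)
  have "{\<eta>. \<eta> > 0 \<and> ?L \<eta> A = 0} \<subseteq> {\<eta>. \<eta> > 0 \<and> ?L \<eta> B = 0}"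
    by (intro Collect_mono impI conjI zero) (elim conjE, assumption)+
  then show ?thesis
    unfolding box_dim_profile_def by (intro Sup_subset_mono Set.insert_mono image_mono)
qed

lemma box_dim_profile_empty: "box_dim_profile \<kappa> {} = 0"
proof -
  have "borel_probs_on {} = {}" by (auto simp: borel_probs_on_def)
  then show ?thesis by (simp add: box_dim_profile_def Liminf_const)
qed

lemma packing_dim_nonneg: "0 \<le> packing_dim (G :: (real^'d) set)"
  unfolding packing_dim_def
proof (rule INF_greatest)
  fix C assume "C \<in> bounded_borel_covers G"
  then have "0 \<le> upper_minkowski_dim (C 0)"
    by (intro upper_minkowski_dim_nonneg) (auto simp: bounded_borel_covers_def)
  then show "0 \<le> (SUP n. upper_minkowski_dim (C n))" by (rule order_trans) (rule SUP_upper, simp)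
qed

text \<open>
  This is how a preimage of a cover of \<open>X(F)\<close> may be replaced by its closure at times where the path is
  continuous.
\<close>

lemma tendsto_within_mem_closure_image:
  fixes f :: "'a::metric_space \<Rightarrow> 'b::metric_space"
  assumes "(f \<longlongrightarrow> f t) (at t within T)" "t \<in> closure S" "S \<subseteq> T"
  shows "f t \<in> closure (f ` S)"
  unfolding closure_approachable
proof (intro allI impI)
  fix e :: real assume "e > 0"
  then have "eventually (\<lambda>s. dist (f s) (f t) < e) (at t within T)" by (rule tendstoD[OF assms(1)])
  then obtain h where h: "h > 0" "\<And>s. s \<in> T \<Longrightarrow> s \<noteq> t \<Longrightarrow> dist s t < h \<Longrightarrow> dist (f s) (f t) < e"
    by (auto simp: eventually_at)
  obtain s where s: "s \<in> S" "dist s t < h" using assms(2) h(1) by (auto simp: closure_approachable)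
  then have "dist (f s) (f t) < e" using h(2)[of s] assms(3) \<open>e > 0\<close> by (cases "s = t") auto
  then show "\<exists>y\<in>f ` S. dist y (f t) < e" using s(1) by blast
qed

context levy_process
begin

text \<open>
  The left limit exists almost surely, and along a sequence of times increasing to \<open>t\<close> fast enough the
  process converges to \<open>X t\<close>, because small-time increments are small in probability.
\<close>

lemma AE_continuous_at_fixed_time:
  assumes "0 \<le> t"
  shows "AE \<omega> in M. ((\<lambda>s. X s \<omega>) \<longlongrightarrow> X t \<omega>) (at t within {0..})"
proof (cases "t = 0")
  case True
  have "{0..} - {0} = {0::real<..}" by auto
  then have "at (0::real) within {0..} = at_right 0" by (simp add: at_within_def)
  then show ?thesis using AE_regular_path True
    by (auto simp: regular_path_def continuous_within elim!: eventually_mono)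
next
  case False
  then have t: "t > 0" using assms by simp
  define a :: "nat \<Rightarrow> real" where "a n = (1 / 2) ^ n" for n
  have a: "a n > 0" for n by (simp add: a_def)
  have a0: "a \<longlonglongrightarrow> 0" unfolding a_def by (intro LIMSEQ_realpow_zero) auto
  have "\<exists>s. 0 < s \<and> s < t \<and> t - a n < s \<and> 1 - a n < \<kappa> (a n) (t - s)" for n
  proof -
    obtain h where h: "h > 0" "\<And>r. 0 \<le> r \<Longrightarrow> r < h \<Longrightarrow> 1 - a n < \<kappa> (a n) r"
      using kappa_near_1[OF a a] by blast
    obtain r where "0 < r" "r < min (min h (a n)) t"
      using dense[of 0 "min (min h (a n)) t"] h(1) a[of n] t by auto
    then have r: "0 < r" "r < h" "r < a n" "r < t" by auto
    have "1 - a n < \<kappa> (a n) r" using r by (intro h(2)) auto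
    then show ?thesis using r by (intro exI[of _ "t - r"]) simp
  qed
  then obtain s where "\<And>n. 0 < s n \<and> s n < t \<and> t - a n < s n \<and> 1 - a n < \<kappa> (a n) (t - s n)" by metis
  then have s: "0 < s n" "s n < t" "t - a n < s n" "1 - a n < \<kappa> (a n) (t - s n)" for n by blast+
  let ?A = "\<lambda>n. {\<omega>\<in>space M. infnorm (X t \<omega> - X (s n) \<omega>) < a n}"
  have A: "?A n \<in> events" for n using t s(1)[of n] by (intro events_infnorm_increment) auto
  have "AE \<omega> in M. eventually (\<lambda>n. \<omega> \<in> space M - (space M - ?A n)) sequentially"
  proof (rule borel_cantelli_AE1)
    show "space M - ?A n \<in> events" for n using A by auto
    show "emeasure M (space M - ?A n) < \<infinity>" for n by (simp add: less_top[symmetric])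
    have le: "prob (space M - ?A n) \<le> a n" for n
    proof -
      have "prob (?A n) = \<kappa> (a n) \<bar>t - s n\<bar>" using t s(1)[of n] by (intro prob_increment) auto
      then show ?thesis using s(2,4)[of n] prob_compl[OF A[of n]] by simp
    qed
    have "summable a" unfolding a_def by (intro summable_geometric) simp
    then show "summable (\<lambda>n. prob (space M - ?A n))"
      by (rule summable_comparison_test'[of a 0]) (simp only: real_norm_def abs_of_nonneg[OF measure_nonneg] le)
  qed
  then show ?thesis using AE_regular_path
  proof eventually_elim
    case (elim \<omega>)
    let ?f = "\<lambda>s. X s \<omega>"
    obtain l where l: "(?f \<longlongrightarrow> l) (at_left t)" using elim(2) t by (auto simp: regular_path_def)
    have "s \<longlonglongrightarrow> t"
    proof (rule tendsto_sandwich)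
      show "(\<lambda>n. t - a n) \<longlonglongrightarrow> t" using tendsto_diff[OF tendsto_const a0] by simp
    qed (use s in \<open>auto intro!: always_eventually less_imp_le\<close>)
    then have "filterlim s (at_left t) sequentially"
      using s(2) by (auto simp: filterlim_at less_imp_neq intro!: always_eventually)
    with l have sl: "(\<lambda>n. ?f (s n)) \<longlonglongrightarrow> l" by (rule filterlim_compose)
    then have "(\<lambda>n. infnorm (X t \<omega> - ?f (s n))) \<longlonglongrightarrow> infnorm (X t \<omega> - l)"
      by (intro tendsto_intros)
    moreover have "(\<lambda>n. infnorm (X t \<omega> - ?f (s n))) \<longlonglongrightarrow> 0"
    proof (rule tendsto_sandwich[OF _ _ tendsto_const a0])
      show "eventually (\<lambda>n. infnorm (X t \<omega> - ?f (s n)) \<le> a n) sequentially"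
        using elim(1) by eventually_elim auto
    qed (simp add: infnorm_pos_le)
    ultimately have "infnorm (X t \<omega> - l) = 0" by (rule LIMSEQ_unique)
    then have "l = X t \<omega>" by (simp add: infnorm_eq_0)
    then have "(?f \<longlongrightarrow> X t \<omega>) (at_left t)" using l by simp
    moreover have "(?f \<longlongrightarrow> X t \<omega>) (at_right t)"
      using elim(2) t by (auto simp: regular_path_def continuous_within)
    ultimately have "(?f \<longlongrightarrow> X t \<omega>) (at t)" by (simp add: filterlim_split_at)
    then show ?case by (rule tendsto_within_subset) simp
  qed
qed

text \<open>
  The images of the pieces of a cover need not be Borel sets, so their closures cover \<open>X(F)\<close>
  instead; the Minkowski dimension does not change.
\<close>

lemma AE_packing_dim_le:
  assumes F: "F \<in> sets borel" "F \<subseteq> {0..}" and q: "packing_dim_profile \<kappa> F < ereal q"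
  shows "AE \<omega> in M. packing_dim ((\<lambda>t. X t \<omega>) ` F) \<le> ereal q"
proof -
  obtain C where C: "C \<in> bounded_borel_covers F" "(SUP n. box_dim_profile \<kappa> (C n)) < ereal q"
    using q by (auto simp: packing_dim_profile_def INF_less_iff)
  then have Cn: "bounded (C n)" "C n \<in> sets borel" and cov: "F \<subseteq> (\<Union>n. C n)" for n
    by (auto simp: bounded_borel_covers_def)
  have piece: "C n \<inter> F \<in> sets borel" "bounded (C n \<inter> F)" "C n \<inter> F \<subseteq> {0..}" for n
    using F Cn[of n] by (auto intro: bounded_subset)
  have box: "box_dim_profile \<kappa> (C n \<inter> F) \<le> ereal q" for n
  proof -
    have "box_dim_profile \<kappa> (C n \<inter> F) \<le> box_dim_profile \<kappa> (C n)"
      using piece(1) Cn(2) by (intro box_dim_profile_mono) auto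
    also have "\<dots> \<le> (SUP n. box_dim_profile \<kappa> (C n))" by (rule SUP_upper) simp
    also have "\<dots> \<le> ereal q" using C(2) by simp
    finally show ?thesis .
  qed
  have "AE \<omega> in M. \<forall>n. upper_minkowski_dim ((\<lambda>t. X t \<omega>) ` (C n \<inter> F)) = box_dim_profile \<kappa> (C n \<inter> F)"
    by (subst AE_all_countable) (intro allI AE_upper_minkowski_dim_eq piece)
  then show ?thesis using AE_regular_path
  proof eventually_elim
    case (elim \<omega>)
    let ?G = "\<lambda>n. (\<lambda>t. X t \<omega>) ` (C n \<inter> F)"
    have b: "bounded (?G n)" for n by (rule regular_path_bounded_image[OF elim(2) piece(2,3)])
    have "(\<lambda>t. X t \<omega>) ` F \<subseteq> (\<Union>n. closure (?G n))"
    proof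
      fix y assume "y \<in> (\<lambda>t. X t \<omega>) ` F"
      then obtain t where "t \<in> F" "y = X t \<omega>" by auto
      moreover from this obtain n where "t \<in> C n" using cov by auto
      ultimately have "y \<in> ?G n" by auto
      then show "y \<in> (\<Union>n. closure (?G n))" using closure_subset[of "?G n"] by blast
    qed
    then have "(\<lambda>n. closure (?G n)) \<in> bounded_borel_covers ((\<lambda>t. X t \<omega>) ` F)"
      using b by (auto simp: bounded_borel_covers_def)
    then have "packing_dim ((\<lambda>t. X t \<omega>) ` F) \<le> (SUP n. upper_minkowski_dim (closure (?G n)))"
      unfolding packing_dim_def by (rule INF_lower)
    also have "\<dots> \<le> ereal q"
    proof (rule SUP_least)
      fix n
      have "upper_minkowski_dim (closure (?G n)) \<le> upper_minkowski_dim (?G n)"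
        by (rule upper_minkowski_dim_subset_closure[OF b order_refl])
      also have "\<dots> \<le> ereal q" using elim(1) box by simp
      finally show "upper_minkowski_dim (closure (?G n)) \<le> ereal q" .
    qed
    finally show ?case .
  qed
qed

text \<open>
  The sets of times that a cover of \<open>X(F)\<close> induces are random, but by \<open>souslin_category\<close> one of
  their closures contains a member of a fixed countable family, to which the almost sure statements
  apply simultaneously.
\<close>

lemma AE_packing_dim_ge:
  assumes F: "F \<in> sets borel" "bounded F" "F \<subseteq> {0..}" and q: "ereal q < packing_dim_profile \<kappa> F"
  shows "AE \<omega> in M. ereal q \<le> packing_dim ((\<lambda>t. X t \<omega>) ` F)"
proof (cases "q < 0")
  case True
  then have "ereal q \<le> 0" by simp
  then show ?thesis using packing_dim_nonneg order_trans by (intro AE_I2) blast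
next
  case False
  define small where "small S \<longleftrightarrow> bounded S \<and> S \<in> sets borel \<and> box_dim_profile \<kappa> S \<le> ereal q" for S :: "real set"
  define \<I> where "\<I> = {E. \<exists>C :: nat \<Rightarrow> real set. (\<forall>n. small (C n)) \<and> E \<subseteq> (\<Union>n. C n)}"
  have "F \<notin> \<I>"
  proof
    assume "F \<in> \<I>"
    then obtain C where C: "C \<in> bounded_borel_covers F" "\<And>n. box_dim_profile \<kappa> (C n) \<le> ereal q"
      unfolding \<I>_def small_def bounded_borel_covers_def by blast
    have "packing_dim_profile \<kappa> F \<le> (SUP n. box_dim_profile \<kappa> (C n))"
      unfolding packing_dim_profile_def by (rule INF_lower[OF C(1)])
    also have "\<dots> \<le> ereal q" by (rule SUP_least) (rule C(2))
    finally show False using q by simp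
  qed
  moreover have "B \<in> \<I>" if "A \<in> \<I>" "B \<subseteq> A" for A B
    using that unfolding \<I>_def by (blast intro: order_trans)
  moreover have "(\<Union>n. A n) \<in> \<I>" if A: "\<And>n::nat. A n \<in> \<I>" for A
  proof -
    have "\<forall>n. \<exists>C :: nat \<Rightarrow> real set. (\<forall>m. small (C m)) \<and> A n \<subseteq> (\<Union>m. C m)"
      using A unfolding \<I>_def by blast
    then obtain C :: "nat \<Rightarrow> nat \<Rightarrow> real set" where C: "\<And>n m. small (C n m)" "\<And>n. A n \<subseteq> (\<Union>m. C n m)"
      by metis
    let ?C = "\<lambda>k. C (fst (prod_decode k)) (snd (prod_decode k))"
    have sub: "C n m \<subseteq> (\<Union>k. ?C k)" for n m
      using UN_upper[of "prod_encode (n, m)" UNIV ?C] by simp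
    have "(\<Union>n. A n) \<subseteq> (\<Union>k. ?C k)"
      by (rule UN_least, rule order_trans[OF C(2)], rule UN_least, rule sub)
    then show ?thesis unfolding \<I>_def by (intro CollectI exI[of _ ?C] conjI allI C(1))
  qed
  moreover have "{} \<in> \<I>"
    unfolding \<I>_def small_def using False
    by (auto intro!: exI[of _ "\<lambda>_. {}"] simp: box_dim_profile_empty)
  ultimately obtain \<E> where \<E>: "countable \<E>" "\<forall>E\<in>\<E>. E \<subseteq> F \<and> E \<notin> \<I>"
    and cat: "\<forall>K. (\<forall>n::nat. closed (K n)) \<longrightarrow> F \<subseteq> (\<Union>n. K n) \<longrightarrow> (\<exists>n. \<exists>E\<in>\<E>. E \<subseteq> K n)"
    by (rule souslin_category[OF souslin_borel[OF F(1)]])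
  have "\<exists>D. D \<subseteq> E \<and> countable D \<and> E \<subseteq> closure D" for E :: "real set"
    using separable[of E] by metis
  then have "\<exists>D. \<forall>E :: real set. D E \<subseteq> E \<and> countable (D E) \<and> E \<subseteq> closure (D E)"
    by (intro choice allI)
  then obtain D where "\<forall>E :: real set. D E \<subseteq> E \<and> countable (D E) \<and> E \<subseteq> closure (D E)" ..
  then have D: "D E \<subseteq> E" "countable (D E)" "E \<subseteq> closure (D E)" for E by simp_all
  have "AE \<omega> in M. ereal q \<le> upper_minkowski_dim ((\<lambda>t. X t \<omega>) ` D E)" if E: "E \<in> \<E>" for E
  proof (rule AE_upper_minkowski_dim_ge)
    have EF: "E \<subseteq> F" "E \<notin> \<I>" using \<E>(2) E by auto
    show "closure E \<in> sets borel" by simp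
    show "closure E \<subseteq> closure (D E)" using D(3)[of E] by (simp add: closure_minimal)
    have DF: "D E \<subseteq> F" using D(1) EF(1) by (rule order_trans)
    show "bounded (D E)" by (rule bounded_subset[OF F(2) DF])
    show "D E \<subseteq> {0..}" by (rule order_trans[OF DF F(3)])
    have "bounded (closure E)" by (rule bounded_closure[OF bounded_subset[OF F(2) EF(1)]])
    then have "small (closure E)" if "box_dim_profile \<kappa> (closure E) \<le> ereal q"
      using that by (simp add: small_def)
    then have "E \<in> \<I>" if "box_dim_profile \<kappa> (closure E) \<le> ereal q"
      using that closure_subset[of E] unfolding \<I>_def by (intro CollectI exI[of _ "\<lambda>_. closure E"]) simp
    with EF(2) show "ereal q < box_dim_profile \<kappa> (closure E)" using not_le by blast
  qed
  then have "AE \<omega> in M. \<forall>E\<in>\<E>. ereal q \<le> upper_minkowski_dim ((\<lambda>t. X t \<omega>) ` D E)"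
    by (subst AE_ball_countable[OF \<E>(1)]) (rule ballI)
  moreover have "AE \<omega> in M. \<forall>t\<in>(\<Union>E\<in>\<E>. D E). ((\<lambda>s. X s \<omega>) \<longlongrightarrow> X t \<omega>) (at t within {0..})"
  proof (subst AE_ball_countable)
    show "countable (\<Union>E\<in>\<E>. D E)" by (rule countable_UN[OF \<E>(1) D(2)])
    show "\<forall>t\<in>(\<Union>E\<in>\<E>. D E). AE \<omega> in M. ((\<lambda>s. X s \<omega>) \<longlongrightarrow> X t \<omega>) (at t within {0..})"
    proof (intro ballI AE_continuous_at_fixed_time)
      fix t assume "t \<in> (\<Union>E\<in>\<E>. D E)"
      then obtain E where "E \<in> \<E>" "t \<in> E" using D(1) by blast
      then show "0 \<le> t" using \<E>(2) F(3) by auto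
    qed
  qed
  ultimately show ?thesis
  proof eventually_elim
    case (elim \<omega>)
    show ?case
      unfolding packing_dim_def
    proof (rule INF_greatest)
      fix G assume "G \<in> bounded_borel_covers ((\<lambda>t. X t \<omega>) ` F)"
      then have G: "bounded (G n)" and cov: "(\<lambda>t. X t \<omega>) ` F \<subseteq> (\<Union>n. G n)" for n
        by (auto simp: bounded_borel_covers_def)
      let ?S = "\<lambda>n. {t \<in> F. X t \<omega> \<in> G n}"
      have "F \<subseteq> (\<Union>n. closure (?S n))"
      proof
        fix t assume "t \<in> F"
        then obtain n where "t \<in> ?S n" using cov by blast
        then show "t \<in> (\<Union>n. closure (?S n))" using closure_subset[of "?S n"] by blast
      qed
      then obtain n E where E: "E \<in> \<E>" "E \<subseteq> closure (?S n)"
        using cat[rule_format, of "\<lambda>n. closure (?S n)"] by auto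
      have "(\<lambda>t. X t \<omega>) ` D E \<subseteq> closure (G n)"
      proof
        fix y assume "y \<in> (\<lambda>t. X t \<omega>) ` D E"
        then obtain t where t: "t \<in> D E" "y = X t \<omega>" by auto
        have "X t \<omega> \<in> closure ((\<lambda>t. X t \<omega>) ` ?S n)"
        proof (rule tendsto_within_mem_closure_image)
          show "((\<lambda>s. X s \<omega>) \<longlongrightarrow> X t \<omega>) (at t within {0..})" using elim(2) E(1) t(1) by blast
          show "t \<in> closure (?S n)" using E(2) D(1) t(1) by blast
          show "?S n \<subseteq> {0..}" using F(3) by auto
        qed
        also have "\<dots> \<subseteq> closure (G n)" by (rule closure_mono) auto
        finally show "y \<in> closure (G n)" using t(2) by simp
      qed
      then have "upper_minkowski_dim ((\<lambda>t. X t \<omega>) ` D E) \<le> upper_minkowski_dim (G n)"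
        by (rule upper_minkowski_dim_subset_closure[OF G])
      also have "\<dots> \<le> (SUP n. upper_minkowski_dim (G n))" by (rule SUP_upper) simp
      finally show "ereal q \<le> (SUP n. upper_minkowski_dim (G n))"
        using elim(1) E(1) by (blast intro: order_trans)
    qed
  qed
qed

lemma AE_packing_dim_eq:
  assumes "F \<in> sets borel" "bounded F" "F \<subseteq> {0..}"
  shows "AE \<omega> in M. packing_dim ((\<lambda>t. X t \<omega>) ` F) = packing_dim_profile \<kappa> F"
  using AE_packing_dim_le[OF assms(1,3)] AE_packing_dim_ge[OF assms] by (rule AE_ereal_eqI)

end

section \<open>The dimensions of the image of a time set\<close>

theorem theorem2p7:
  fixes M :: "'w measure" and X :: "real \<Rightarrow> 'w \<Rightarrow> real ^ 'd" and F :: "real set"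
  assumes "levy_process M X"
    and "F \<in> sets borel" and "bounded F" and "F \<subseteq> {0..}"
  shows "(AE \<omega> in M. upper_minkowski_dim ((\<lambda>t. X t \<omega>) ` F)
            = box_dim_profile (small_ball_family M X) F) \<and>
         (AE \<omega> in M. packing_dim ((\<lambda>t. X t \<omega>) ` F)
            = packing_dim_profile (small_ball_family M X) F)"
proof -
  interpret levy_process M X by fact
  show ?thesis using AE_upper_minkowski_dim_eq AE_packing_dim_eq assms(2-4) by blast
qed

end
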